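(* Let $f\colon \mathbb{C}^2\to\mathbb{C}^2$ be the polynomial map $f(x,y) = (x^2-y^4,\,y^4)$, and let $\nu\colon\mathbb{N}\to\mathbb{R}$ be any function. Then there exist germs of holomorphic curves $C$ and $D$ through the origin $0\in\mathbb{C}^2$ such that the local intersection multiplicities at the origin $\mu(n) := C\cdot f^n(D)$ are finite for every $n\geq 0$, and such that $\mu(n)>\nu(n)$ for infinitely many $n$.
   Context: $\mathbb{N}=\{0,1,2,\dots\}$, and $f^n$ denotes the $n$-fold composition of $f$ with itself. The map $f$ fixes the origin and is finite-to-one near it, so for a germ of holomorphic curve $D$ at $0\in\mathbb{C}^2$ the image $f^n(D)$ is again a germ of holomorphic curve at $0$. For curve germs $C=\{\varphi=0\}$ and $C'=\{\psi=0\}$ at the origin ($\varphi,\psi$ being reduced local defining equations), the local intersection multiplicity is $C\cdot C' = \dim_{\mathbb{C}}\mathbb{C}\{x,y\}/(\varphi,\psi)\in\mathbb{N}\cup\{+\infty\}$, where $\mathbb{C}\{x,y\}$ is the ring of convergent power series. *)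

theory Defs
  imports
    "HOL-Analysis.Analysis"
    "HOL-Computational_Algebra.Computational_Algebra"
    "HOL-Algebra.Algebraic_Closure_Type"
    "HOL-Algebra.Embedded_Algebras"
    "HOL-Algebra.QuotRing"
begin

unbundle no vec_syntax

section \<open>The ring of convergent power series in two variables\<close>

text \<open>
  A bivariate power series is an element \<open>F\<close> of \<open>complex fps fps\<close>; the coefficient of
  \<open>x ^ i * y ^ j\<close> is \<open>F $ i $ j\<close>.
\<close>

definition fps2_convergent :: "complex fps fps \<Rightarrow> bool" where
  "fps2_convergent F \<longleftrightarrow>
     (\<exists>r>0. (\<lambda>(i, j). norm (F $ i $ j) * r ^ (i + j)) summable_on UNIV)"

lemma fps2_convergent_iff_bounded:
  "fps2_convergent F \<longleftrightarrow> (\<exists>r>0. \<exists>M. \<forall>i j. norm (F $ i $ j) * r ^ (i + j) \<le> M)"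
proof
  assume "fps2_convergent F"
  then obtain r where r: "r > 0"
    and s: "(\<lambda>(i, j). norm (F $ i $ j) * r ^ (i + j)) summable_on UNIV"
    unfolding fps2_convergent_def by blast
  let ?g = "\<lambda>(i, j). norm (F $ i $ j) * r ^ (i + j)"
  have "?g p \<le> infsum ?g UNIV" for p
  proof -
    have "sum ?g {p} \<le> infsum ?g UNIV"
      by (rule finite_sum_le_infsum[OF s]) (use r in auto)
    then show ?thesis by simp
  qed
  then have "norm (F $ i $ j) * r ^ (i + j) \<le> infsum ?g UNIV" for i j
    by (metis (no_types, lifting) case_prod_conv)
  then show "\<exists>r>0. \<exists>M. \<forall>i j. norm (F $ i $ j) * r ^ (i + j) \<le> M"
    using r by blast
next
  assume "\<exists>r>0. \<exists>M. \<forall>i j. norm (F $ i $ j) * r ^ (i + j) \<le> M"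
  then obtain r M where r: "r > 0" and M: "\<And>i j. norm (F $ i $ j) * r ^ (i + j) \<le> M"
    by blast
  have geo: "(\<lambda>i. (1/2) ^ i :: real) summable_on UNIV"
    by (rule norm_summable_imp_summable_on) (simp add: norm_power)
  have "(\<lambda>(i, j). (1/2) ^ i * (1/2) ^ j :: real) summable_on UNIV \<times> UNIV"
    by (rule summable_on_SigmaI[where g = "\<lambda>i. (1/2) ^ i * 2"])
       (auto intro!: has_sum_cmult_right summable_on_cmult_left geo
          norm_summable_imp_has_sum[where f = "\<lambda>j. (1/2) ^ j"]
          simp: norm_power sums_iff suminf_geometric)
  then have "(\<lambda>p. M * (case p of (i, j) \<Rightarrow> (1/2) ^ i * (1/2) ^ j)) summable_on UNIV"
    by (intro summable_on_cmult_right) simp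
  then have "(\<lambda>(i, j). norm (F $ i $ j) * (r/2) ^ (i + j)) summable_on UNIV"
  proof (rule summable_on_comparison_test)
    fix p :: "nat \<times> nat"
    obtain i j where p: "p = (i, j)" by force
    have "norm (F $ i $ j) * (r/2) ^ (i + j)
            = (norm (F $ i $ j) * r ^ (i + j)) * ((1/2) ^ i * (1/2) ^ j)"
      by (simp add: power_divide power_add field_simps)
    also have "\<dots> \<le> M * ((1/2) ^ i * (1/2) ^ j)"
      by (intro mult_right_mono M) auto
    finally show "(case p of (i, j) \<Rightarrow> norm (F $ i $ j) * (r/2) ^ (i + j))
        \<le> M * (case p of (i, j) \<Rightarrow> (1/2) ^ i * (1/2) ^ j)"
      by (simp add: p)
  qed (use r in auto)
  then show "fps2_convergent F"
    unfolding fps2_convergent_def using r by (intro exI[of _ "r/2"]) auto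
qed

lemma fps2_convergentI:
  assumes "r > 0" "\<And>i j. norm (F $ i $ j) * r ^ (i + j) \<le> M"
  shows "fps2_convergent F"
  using assms unfolding fps2_convergent_iff_bounded by blast

lemma fps2_convergent_const: "fps2_convergent (fps_const (fps_const c))"
  by (rule fps2_convergentI[of 1 _ "norm c"]) auto

lemma fps2_convergent_uminus: "fps2_convergent F \<Longrightarrow> fps2_convergent (- F)"
  by (simp add: fps2_convergent_def)

lemma fps2_convergent_common_radius:
  assumes "fps2_convergent F" "fps2_convergent G"
  obtains r M where "r > 0" "M \<ge> 0"
    "\<And>i j. norm (F $ i $ j) * r ^ (i + j) \<le> M"
    "\<And>i j. norm (G $ i $ j) * r ^ (i + j) \<le> M"
proof -
  obtain r1 M1 where 1: "r1 > 0" "\<And>i j. norm (F $ i $ j) * r1 ^ (i + j) \<le> M1"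
    using assms(1) unfolding fps2_convergent_iff_bounded by blast
  obtain r2 M2 where 2: "r2 > 0" "\<And>i j. norm (G $ i $ j) * r2 ^ (i + j) \<le> M2"
    using assms(2) unfolding fps2_convergent_iff_bounded by blast
  have "norm (F $ i $ j) * (min r1 r2) ^ (i + j) \<le> max 0 (max M1 M2)" for i j
  proof -
    have "norm (F $ i $ j) * (min r1 r2) ^ (i + j) \<le> norm (F $ i $ j) * r1 ^ (i + j)"
      using 1 2 by (intro mult_left_mono power_mono) auto
    with 1(2)[of i j] show ?thesis by linarith
  qed
  moreover have "norm (G $ i $ j) * (min r1 r2) ^ (i + j) \<le> max 0 (max M1 M2)" for i j
  proof -
    have "norm (G $ i $ j) * (min r1 r2) ^ (i + j) \<le> norm (G $ i $ j) * r2 ^ (i + j)"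
      using 1 2 by (intro mult_left_mono power_mono) auto
    with 2(2)[of i j] show ?thesis by linarith
  qed
  ultimately show ?thesis
    using 1(1) 2(1) by (intro that[of "min r1 r2" "max 0 (max M1 M2)"]) auto
qed

lemma fps2_convergent_add:
  assumes "fps2_convergent F" "fps2_convergent G"
  shows "fps2_convergent (F + G)"
proof -
  obtain r M where *: "r > 0" "M \<ge> 0"
    "\<And>i j. norm (F $ i $ j) * r ^ (i + j) \<le> M"
    "\<And>i j. norm (G $ i $ j) * r ^ (i + j) \<le> M"
    using fps2_convergent_common_radius[OF assms] by blast
  show ?thesis
  proof (rule fps2_convergentI[OF *(1)])
    fix i j
    have "norm ((F + G) $ i $ j) * r ^ (i + j)
        \<le> (norm (F $ i $ j) + norm (G $ i $ j)) * r ^ (i + j)"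
      using *(1) by (intro mult_right_mono) (auto intro: norm_triangle_ineq)
    also have "\<dots> \<le> M + M"
      using *(3,4)[of i j] by (simp add: distrib_right)
    finally show "norm ((F + G) $ i $ j) * r ^ (i + j) \<le> M + M" .
  qed
qed

lemma fps2_mult_nth:
  "(F * G) $ i $ j =
     (\<Sum>k\<le>i. \<Sum>l\<le>j. F $ k $ l * G $ (i - k) $ (j - l))"
  by (simp add: fps_mult_nth fps_sum_nth atMost_atLeast0)

lemma fps2_convergent_mult:
  assumes "fps2_convergent F" "fps2_convergent G"
  shows "fps2_convergent (F * G)"
proof -
  obtain r M where *: "r > 0" "M \<ge> 0"
    "\<And>i j. norm (F $ i $ j) * r ^ (i + j) \<le> M"
    "\<And>i j. norm (G $ i $ j) * r ^ (i + j) \<le> M"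
    using fps2_convergent_common_radius[OF assms] by blast
  show ?thesis
  proof (rule fps2_convergentI[of "r/2" _ "M * M"])
    show "r / 2 > 0" using *(1) by simp
    fix i j
    have "norm ((F * G) $ i $ j) * r ^ (i + j)
        \<le> (\<Sum>k\<le>i. \<Sum>l\<le>j. norm (F $ k $ l) * norm (G $ (i - k) $ (j - l))) * r ^ (i + j)"
      unfolding fps2_mult_nth using *(1)
      by (intro mult_right_mono sum_norm_le) (auto simp: norm_mult)
    also have "\<dots> = (\<Sum>k\<le>i. \<Sum>l\<le>j. (norm (F $ k $ l) * r ^ (k + l)) *
        (norm (G $ (i - k) $ (j - l)) * r ^ ((i - k) + (j - l))))"
      unfolding sum_distrib_right
    proof (intro sum.cong refl)
      fix k l assume "k \<in> {..i}" "l \<in> {..j}"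
      then have "i + j = (k + l) + ((i - k) + (j - l))" by auto
      then have "r ^ (i + j) = r ^ (k + l) * r ^ ((i - k) + (j - l))"
        by (metis power_add)
      then show "norm (F $ k $ l) * norm (G $ (i - k) $ (j - l)) * r ^ (i + j)
          = (norm (F $ k $ l) * r ^ (k + l)) *
            (norm (G $ (i - k) $ (j - l)) * r ^ ((i - k) + (j - l)))"
        by simp
    qed
    also have "\<dots> \<le> (\<Sum>k\<le>i. \<Sum>l\<le>j. M * M)"
    proof (intro sum_mono)
      fix k l
      show "(norm (F $ k $ l) * r ^ (k + l)) * (norm (G $ (i - k) $ (j - l)) * r ^ ((i - k) + (j - l)))
          \<le> M * M"
        using *(1) by (intro mult_mono *(2-4) mult_nonneg_nonneg) auto
    qed
    also have "\<dots> = (real (i + 1) * real (j + 1)) * (M * M)"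
      by simp
    also have "\<dots> \<le> (2 ^ i * 2 ^ j) * (M * M)"
    proof -
      have "real (n + 1) \<le> 2 ^ n" for n
        using of_nat_mono[of "n + 1" "2 ^ n", where 'a = real] less_exp[of n] by simp
      then show ?thesis by (intro mult_right_mono mult_mono) auto
    qed
    finally show "norm ((F * G) $ i $ j) * (r / 2) ^ (i + j) \<le> M * M"
      by (simp add: power_divide power_add field_simps)
  qed
qed

typedef conv_fps2 = "{F :: complex fps fps. fps2_convergent F}"
  morphisms fps2_of_conv conv_of_fps2
  using fps2_convergent_const by blast

setup_lifting type_definition_conv_fps2

instantiation conv_fps2 :: idom
begin

lift_definition zero_conv_fps2 :: conv_fps2 is 0
  using fps2_convergent_const[of 0] by simp

lift_definition one_conv_fps2 :: conv_fps2 is 1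
  using fps2_convergent_const[of 1] by simp

lift_definition plus_conv_fps2 :: "conv_fps2 \<Rightarrow> conv_fps2 \<Rightarrow> conv_fps2" is "(+)"
  by (rule fps2_convergent_add)

lift_definition uminus_conv_fps2 :: "conv_fps2 \<Rightarrow> conv_fps2" is uminus
  by (rule fps2_convergent_uminus)

lift_definition minus_conv_fps2 :: "conv_fps2 \<Rightarrow> conv_fps2 \<Rightarrow> conv_fps2" is "(-)"
  by (metis diff_conv_add_uminus fps2_convergent_add fps2_convergent_uminus)

lift_definition times_conv_fps2 :: "conv_fps2 \<Rightarrow> conv_fps2 \<Rightarrow> conv_fps2" is "(*)"
  by (rule fps2_convergent_mult)

instance
  by standard (transfer; simp add: algebra_simps; fail)+

end

lift_definition const_conv_fps2 :: "complex \<Rightarrow> conv_fps2" is "\<lambda>c. fps_const (fps_const c)"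
  by (rule fps2_convergent_const)

text \<open>The value is meaningful only near the origin, where the double series converges absolutely.\<close>

definition eval_conv_fps2 :: "conv_fps2 \<Rightarrow> complex \<times> complex \<Rightarrow> complex" where
  "eval_conv_fps2 F = (\<lambda>(x, y). \<Sum>\<^sub>\<infinity>(i, j). fps2_of_conv F $ i $ j * x ^ i * y ^ j)"


section \<open>Germs at the origin\<close>

quotient_type set_germ = "(complex \<times> complex) set" /
  "\<lambda>A B. \<forall>\<^sub>F z in nhds 0. z \<in> A \<longleftrightarrow> z \<in> B"
proof (rule equivpI)
  show "transp (\<lambda>A B. \<forall>\<^sub>F z :: complex \<times> complex in nhds 0. z \<in> A \<longleftrightarrow> z \<in> B)"
    by (rule transpI) (erule (1) eventually_elim2, blast)
qed (auto intro!: reflpI sympI elim: eventually_mono)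

lift_definition germ :: "(complex \<times> complex) set \<Rightarrow> set_germ" is "\<lambda>A. A" .

text \<open>
  Squarefreeness in the (factorial) ring of convergent power series says that \<open>F\<close> is reduced, and
  it excludes \<open>F = 0\<close>. The condition at the origin excludes units, i.e. the empty germ.
\<close>

definition reduced_local_equation :: "conv_fps2 \<Rightarrow> set_germ \<Rightarrow> bool" where
  "reduced_local_equation F C \<longleftrightarrow>
     squarefree F \<and> eval_conv_fps2 F 0 = 0 \<and> C = germ {z. eval_conv_fps2 F z = 0}"

definition curve_germ :: "set_germ \<Rightarrow> bool" where
  "curve_germ C \<longleftrightarrow> (\<exists>F. reduced_local_equation F C)"

text \<open>
  The germ of \<open>f ` (A \<inter> U)\<close> may depend on \<open>U\<close>, since \<open>f\<close> can map points far from the origin close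
  to it; the image germ is the common value for all sufficiently small neighbourhoods \<open>U\<close>. For
  \<open>f\<close> fixing the origin and finite-to-one near it, and \<open>A\<close> representing a curve germ, this
  common value exists.
\<close>

definition image_germ ::
    "(complex \<times> complex \<Rightarrow> complex \<times> complex) \<Rightarrow> set_germ \<Rightarrow> set_germ" where
  "image_germ f D = (THE E. \<forall>A. germ A = D \<longrightarrow>
     (\<exists>U\<^sub>0. open U\<^sub>0 \<and> 0 \<in> U\<^sub>0 \<and>
        (\<forall>U. open U \<and> 0 \<in> U \<and> U \<subseteq> U\<^sub>0 \<longrightarrow> germ (f ` (A \<inter> U)) = E)))"


section \<open>Local intersection multiplicity\<close>

definition local_algebra :: "conv_fps2 \<Rightarrow> conv_fps2 \<Rightarrow> conv_fps2 set ring" where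
  "local_algebra F G = ring_of_type_algebra Quot (genideal ring_of_type_algebra {F, G})"

text \<open>The image of the field of constants, over which the dimension is taken.\<close>

definition local_algebra_scalars :: "conv_fps2 \<Rightarrow> conv_fps2 \<Rightarrow> conv_fps2 set set" where
  "local_algebra_scalars F G =
     range (\<lambda>c. genideal ring_of_type_algebra {F, G} +>\<^bsub>ring_of_type_algebra\<^esub> const_conv_fps2 c)"

definition local_algebra_dim :: "conv_fps2 \<Rightarrow> conv_fps2 \<Rightarrow> enat" where
  "local_algebra_dim F G =
     (let R = local_algebra F G; K = local_algebra_scalars F G in
      if \<exists>n. ring.dimension R n K (carrier R)
      then enat (THE n. ring.dimension R n K (carrier R)) else \<infinity>)"

text \<open>
  Reduced local equations of a curve germ are unique up to units, so the choice of \<open>F\<close> and \<open>G\<close>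
  does not matter.
\<close>

definition intersection_multiplicity :: "set_germ \<Rightarrow> set_germ \<Rightarrow> enat" where
  "intersection_multiplicity C C' =
     local_algebra_dim (SOME F. reduced_local_equation F C) (SOME G. reduced_local_equation G C')"


definition f_map :: "complex \<times> complex \<Rightarrow> complex \<times> complex" where
  "f_map = (\<lambda>(x, y). (x ^ 2 - y ^ 4, y ^ 4))"

end

theory Submission
  imports
    Defs
    "HOL-Complex_Analysis.Great_Picard"
    "HOL-Complex_Analysis.Laurent_Convergence"
begin

text \<open>
  \<^bold>\<open>Idea.\<close> The preimages of a graph \<open>x = g(y)\<close>, where \<open>g\<close> vanishes to order at least two, under
  \<open>f(x, y) = (x\<^sup>2 - y\<^sup>4, y\<^sup>4)\<close> are again graphs: \<open>x\<^sup>2 = y\<^sup>4 + g(y\<^sup>4)\<close> has the two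
  holomorphic solutions \<open>x = \<plusminus>y\<^sup>2 (1 + g(y\<^sup>4) / y\<^sup>4)\<^bsup>1/2\<^esup>\<close>. Choosing one sign after the
  other, one obtains for every sequence \<open>s\<close> of signs a graph \<open>x = g\<^sub>s(y)\<close> with
  \<open>g\<^sub>s(y)\<^sup>2 = y\<^sup>4 + g\<^sub>\<sigma>\<^sub>s(y\<^sup>4)\<close>, where \<open>\<sigma>\<close> deletes the first sign. Hence \<open>f\<close> acts on this
  family of curves as the shift on sign sequences (\<open>image_germ_branch\<close>).

  Two such graphs are tangent to an order that grows with the length of the common prefix of their
  codes (\<open>subdegree_branch_diff_ge\<close>), but they are distinct whenever the codes are
  (\<open>inj_branch\<close>). Now let \<open>C\<close> be the graph with the constant code, and let \<open>D\<close> be the graph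
  whose code consists of blocks of that constant sign, separated by single opposite signs. At the
  time \<open>n\<close> when the \<open>j\<close>-th block begins, the curve \<open>f\<^sup>n(D)\<close> is tangent to \<open>C\<close> to an
  order at least the length of the block, and this length can be chosen larger than \<open>\<nu>(n)\<close>. Since
  the separating signs recur for ever, \<open>f\<^sup>n(D)\<close> never equals \<open>C\<close>, so all multiplicities are
  finite.

  What remains is to compute the multiplicity of two graphs \<open>x = g(y)\<close> and \<open>x = h(y)\<close> as the
  order of vanishing of \<open>g - h\<close> (\<open>intersection_multiplicity_graph_germs\<close>). As the multiplicity is
  defined through arbitrary reduced equations of the two germs, one has to know that such an
  equation is a unit times \<open>x - g(y)\<close> (\<open>reduced_local_equation_graph_germ_unique\<close>). This combines
  division by \<open>x - g(y)\<close> with the fact that a holomorphic function of two variables has no isolated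
  zeros (\<open>eval_conv_fps2_zeros_not_isolated\<close>).
\<close>

unbundle no vec_syntax


section \<open>Division by the equation of a graph\<close>

text \<open>
  Substituting \<open>x = g(y)\<close> in \<open>F = \<Sum>\<^sub>i F\<^sub>i(y) x\<^sup>i\<close> by Horner's scheme produces the tails
  \<open>\<Sum>\<^sub>b F\<^sub>a\<^sub>+\<^sub>b g\<^sup>b\<close>. They make sense as formal series because \<open>g(0) = 0\<close> makes the
  coefficient of \<open>y\<^sup>j\<close> in \<open>g\<^sup>b\<close> vanish for \<open>b > j\<close>. The tail at \<open>0\<close> is \<open>F(g(y), y)\<close>, and the later
  ones are the coefficients of the quotient of \<open>F\<close> by \<open>x - g(y)\<close>.
\<close>

definition graph_tail :: "complex fps \<Rightarrow> complex fps fps \<Rightarrow> nat \<Rightarrow> complex fps" where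
  "graph_tail g F a = Abs_fps (\<lambda>j. \<Sum>b\<le>j. (F $ (a + b) * g ^ b) $ j)"

lemma fps_mult_power_nth_eq_0:
  fixes u g :: "complex fps"
  assumes "g $ 0 = 0" "j < b"
  shows "(u * g ^ b) $ j = 0"
proof -
  have "(g ^ b) $ k = 0" if "k < b" for k
    using startsby_zero_power_prefix[OF assms(1)] that by blast
  then show ?thesis
    using assms(2) by (simp add: fps_mult_nth)
qed

lemma graph_tail_rec:
  assumes g: "g $ 0 = 0"
  shows "graph_tail g F a = F $ a + g * graph_tail g F (Suc a)"
proof (rule fps_ext)
  fix j
  let ?T = "\<lambda>b. F $ (a + b) * g ^ b"
  let ?S = "\<lambda>b. F $ (Suc a + b) * g ^ b"
  have tail: "graph_tail g F (Suc a) $ k = (\<Sum>b\<le>j. ?S b $ k)" if "k \<le> j" for k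
    unfolding graph_tail_def fps_nth_Abs_fps using that fps_mult_power_nth_eq_0[OF g]
    by (intro sum.mono_neutral_left) auto
  have "(g * graph_tail g F (Suc a)) $ j = (\<Sum>i\<le>j. g $ i * (\<Sum>b\<le>j. ?S b $ (j - i)))"
    unfolding fps_mult_nth[of g] atMost_atLeast0[symmetric] by (intro sum.cong refl) (subst tail, simp_all)
  also have "\<dots> = (\<Sum>b\<le>j. (g * ?S b) $ j)"
    unfolding fps_mult_nth[of g] atMost_atLeast0[symmetric] sum_distrib_left by (rule sum.swap)
  also have "\<dots> = (\<Sum>b\<le>j. ?T (Suc b) $ j)"
    by (simp add: mult_ac)
  also have "\<dots> = (\<Sum>b<j. ?T (Suc b) $ j)"
    using fps_mult_power_nth_eq_0[OF g, of j "Suc j"]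
    by (simp add: lessThan_Suc_atMost[symmetric] del: power_Suc)
  finally show "graph_tail g F a $ j = (F $ a + g * graph_tail g F (Suc a)) $ j"
    by (simp add: graph_tail_def sum.atMost_shift)
qed

definition graph_restrict :: "complex fps \<Rightarrow> complex fps fps \<Rightarrow> complex fps" where
  "graph_restrict g F = graph_tail g F 0"

definition graph_quotient :: "complex fps \<Rightarrow> complex fps fps \<Rightarrow> complex fps fps" where
  "graph_quotient g F = Abs_fps (\<lambda>a. graph_tail g F (Suc a))"

text \<open>
  Comparing coefficients of \<open>x\<^sup>a\<close>, this is the recursion \<open>graph_tail_rec\<close>.
\<close>

lemma graph_division:
  assumes g: "g $ 0 = 0"
  shows "F = fps_const (graph_restrict g F) + (fps_X - fps_const g) * graph_quotient g F"
proof (rule fps_ext)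
  fix a
  show "F $ a = (fps_const (graph_restrict g F) + (fps_X - fps_const g) * graph_quotient g F) $ a"
    using graph_tail_rec[OF g, of F a]
    by (cases a) (simp_all add: graph_restrict_def graph_quotient_def algebra_simps)
qed

text \<open>
  A quotient \<open>Q\<close> would satisfy \<open>Q\<^sub>a = g Q\<^sub>a\<^sub>+\<^sub>1\<close> for all \<open>a\<close>, so \<open>Q\<^sub>0\<close> would be divisible by
  every power of \<open>g\<close>.
\<close>

lemma graph_remainder_unique:
  fixes g u :: "complex fps"
  assumes g: "g $ 0 = 0" and eq: "fps_const u = (fps_X - fps_const g) * Q"
  shows "u = 0"
proof -
  have step: "Q $ a = g * Q $ Suc a" for a
    using arg_cong[OF eq, of "\<lambda>F. F $ Suc a"] by (simp add: algebra_simps)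
  have Q: "Q $ a = Q $ (a + b) * g ^ b" for a b
  proof (induction b)
    case (Suc b)
    then show ?case using step[of "a + b"] by (simp add: mult_ac)
  qed simp
  have "Q $ 0 $ j = 0" for j
    using fps_mult_power_nth_eq_0[OF g, of j "Suc j" "Q $ (0 + Suc j)"] Q[of 0 "Suc j"] by simp
  then have "Q $ 0 = 0"
    by (intro fps_ext) simp
  then show ?thesis
    using arg_cong[OF eq, of "\<lambda>F. F $ 0"] by (simp add: algebra_simps)
qed

text \<open>
  By uniqueness of the remainder, any division by \<open>x - g(y)\<close> computes the restriction to the graph;
  in particular the restriction is a ring homomorphism.
\<close>

lemma graph_restrict_eqI:
  assumes g: "g $ 0 = 0" and F: "F = fps_const u + (fps_X - fps_const g) * Q"
  shows "graph_restrict g F = u"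
proof -
  have "fps_const (graph_restrict g F) + (fps_X - fps_const g) * graph_quotient g F
          = fps_const u + (fps_X - fps_const g) * Q"
    using graph_division[OF g, of F] F by argo
  then have "fps_const (graph_restrict g F - u) = (fps_X - fps_const g) * (Q - graph_quotient g F)"
    by (simp add: algebra_simps flip: fps_const_sub)
  then show ?thesis
    using graph_remainder_unique[OF g] by force
qed

lemma graph_restrict_const [simp]: "g $ 0 = 0 \<Longrightarrow> graph_restrict g (fps_const u) = u"
  by (rule graph_restrict_eqI[where Q = 0]) auto

lemma graph_restrict_add:
  assumes g: "g $ 0 = 0"
  shows "graph_restrict g (F + G) = graph_restrict g F + graph_restrict g G"
proof (rule graph_restrict_eqI[OF g])
  show "F + G = fps_const (graph_restrict g F + graph_restrict g G)
          + (fps_X - fps_const g) * (graph_quotient g F + graph_quotient g G)"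
    by (subst (1) graph_division[OF g, of F], subst (1) graph_division[OF g, of G])
       (simp add: algebra_simps flip: fps_const_add)
qed

lemma graph_restrict_mult:
  assumes g: "g $ 0 = 0"
  shows "graph_restrict g (F * G) = graph_restrict g F * graph_restrict g G"
proof (rule graph_restrict_eqI[OF g])
  define r where "r F = fps_const (graph_restrict g F)" for F
  define q where "q = graph_quotient g"
  define p where "p = fps_X - fps_const g"
  have "F = r F + p * q F" for F
    unfolding r_def p_def q_def by (rule graph_division[OF g])
  then have "F * G = (r F + p * q F) * (r G + p * q G)"
    by metis
  also have "\<dots> = r F * r G + p * (q F * (r G + p * q G) + r F * q G)"
    by (simp add: algebra_simps)
  finally show "F * G = fps_const (graph_restrict g F * graph_restrict g G)
          + (fps_X - fps_const g) * (q F * (r G + p * q G) + r F * q G)"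
    by (simp add: r_def p_def)
qed

lemma graph_restrict_graph_equation:
  fixes g h :: "complex fps"
  assumes "g $ 0 = 0"
  shows "graph_restrict g (fps_X - fps_const h) = g - h"
  using assms by (intro graph_restrict_eqI[where Q = 1]) (auto simp: algebra_simps simp flip: fps_const_sub)


section \<open>Convergence of restrictions, quotients and inverses\<close>

text \<open>
  A bound by powers of a single constant is convenient because enlarging that constant absorbs all
  polynomial and constant factors that arise in products.
\<close>

lemma fps2_convergent_iff_exponential_bound:
  "fps2_convergent F \<longleftrightarrow> (\<exists>K\<ge>1. \<forall>i j. norm (F $ i $ j) \<le> K ^ (i + j + 1))"
proof
  assume "fps2_convergent F"
  then obtain r M where r: "r > 0" and M: "\<And>i j. norm (F $ i $ j) * r ^ (i + j) \<le> M"
    unfolding fps2_convergent_iff_bounded by blast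
  define K where "K = max 1 (max M (1 / r))"
  have K: "K \<ge> 1" "K \<ge> M" "K \<ge> 1 / r"
    by (auto simp: K_def)
  have "norm (F $ i $ j) \<le> K ^ (i + j + 1)" for i j
  proof -
    have "norm (F $ i $ j) \<le> M * (1 / r) ^ (i + j)"
      using M[of i j] r by (simp add: field_simps)
    also have "\<dots> \<le> K * K ^ (i + j)"
      using K r by (intro mult_mono power_mono) auto
    finally show ?thesis by simp
  qed
  then show "\<exists>K\<ge>1. \<forall>i j. norm (F $ i $ j) \<le> K ^ (i + j + 1)"
    using K(1) by blast
next
  assume "\<exists>K\<ge>1. \<forall>i j. norm (F $ i $ j) \<le> K ^ (i + j + 1)"
  then obtain K where K: "K \<ge> 1" "\<And>i j. norm (F $ i $ j) \<le> K ^ (i + j + 1)"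
    by blast
  show "fps2_convergent F"
  proof (rule fps2_convergentI[of "1 / K" _ K])
    fix i j
    show "norm (F $ i $ j) * (1 / K) ^ (i + j) \<le> K"
      using K(2)[of i j] K(1) by (simp add: power_divide divide_simps)
  qed (use K in auto)
qed

lemma fps2_convergent_fps_const_iff:
  "fps2_convergent (fps_const u) \<longleftrightarrow> fps_conv_radius u > 0"
proof
  assume "fps_conv_radius u > 0"
  then obtain r where r: "r > 0" "ereal r < fps_conv_radius u"
    using ereal_dense2 by (metis ereal_less(2) zero_ereal_def)
  then have "summable (\<lambda>j. norm (u $ j * of_real r ^ j))"
    by (intro abs_summable_in_conv_radius) (auto simp: fps_conv_radius_def)
  then have "Bseq (\<lambda>j. norm (u $ j * of_real r ^ j))"
    by (metis convergentI convergent_imp_Bseq summable_LIMSEQ_zero)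
  then obtain M where M: "\<And>j. norm (u $ j) * r ^ j \<le> M" and "M > 0"
    using r(1) by (auto simp: Bseq_def norm_mult norm_power)
  show "fps2_convergent (fps_const u)"
  proof (rule fps2_convergentI[OF r(1)])
    fix i j
    show "norm (fps_const u $ i $ j) * r ^ (i + j) \<le> M"
      using M[of j] \<open>M > 0\<close> by (cases i) auto
  qed
next
  assume "fps2_convergent (fps_const u)"
  then obtain r M where r: "r > 0" and M: "\<And>i j. norm (fps_const u $ i $ j) * r ^ (i + j) \<le> M"
    unfolding fps2_convergent_iff_bounded by blast
  have "summable (\<lambda>j. u $ j * of_real (r / 2) ^ j)"
  proof (rule summable_comparison_test')
    show "summable (\<lambda>j. M * (1 / 2) ^ j)"
      by (intro summable_mult summable_geometric) auto
    fix j
    show "norm (u $ j * of_real (r / 2) ^ j) \<le> M * (1 / 2) ^ j"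
      using M[of 0 j] r by (simp add: norm_mult norm_power norm_divide power_divide field_simps)
  qed
  then have "ereal (norm (of_real (r / 2) :: complex)) \<le> fps_conv_radius u"
    unfolding fps_conv_radius_def by (rule conv_radius_geI)
  moreover have "norm (of_real (r / 2) :: complex) = r / 2"
    using r by (simp add: norm_divide)
  moreover have "0 < ereal (r / 2)"
    using r by simp
  ultimately show "fps_conv_radius u > 0"
    using less_le_trans by metis
qed

text \<open>
  The bound is uniform in the exponent \<open>b\<close>: as \<open>g(0) = 0\<close>, multiplying once more by \<open>g\<close> costs only
  the factor \<open>1/2 + 1/4 + \<dots> \<le> 1\<close>.
\<close>

lemma fps_power_nth_bound:
  fixes g :: "complex fps"
  assumes g: "g $ 0 = 0" and K: "K \<ge> 0" and bound: "\<And>j. norm (g $ j) \<le> K ^ j"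
  shows "norm ((g ^ b) $ j) \<le> (2 * K) ^ j"
proof (induction b arbitrary: j)
  case 0
  then show ?case using K by simp
next
  case (Suc b)
  define w where "w i = (if i = 0 then 0 else (1 / 2) ^ i :: real)" for i :: nat
  have "norm ((g ^ Suc b) $ j) \<le> (\<Sum>i\<le>j. norm (g $ i * (g ^ b) $ (j - i)))"
    unfolding power_Suc fps_mult_nth[of g] atMost_atLeast0[symmetric] by (rule norm_sum)
  also have "\<dots> \<le> (\<Sum>i\<le>j. (2 * K) ^ j * w i)"
  proof (rule sum_mono)
    fix i assume "i \<in> {..j}"
    then have "(2 * K) ^ j = (2 * K) ^ i * (2 * K) ^ (j - i)"
      by (metis atMost_iff le_add_diff_inverse power_add)
    then have *: "(2 * K) ^ j * (1 / 2) ^ i = K ^ i * (2 * K) ^ (j - i)"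
      by (simp add: power_mult_distrib power_divide)
    show "norm (g $ i * (g ^ b) $ (j - i)) \<le> (2 * K) ^ j * w i"
    proof (cases "i = 0")
      case False
      have "norm (g $ i * (g ^ b) $ (j - i)) \<le> K ^ i * (2 * K) ^ (j - i)"
        unfolding norm_mult using K by (intro mult_mono bound Suc.IH) auto
      then show ?thesis using False * by (simp add: w_def)
    qed (simp add: g w_def)
  qed
  also have "\<dots> = (2 * K) ^ j * (\<Sum>i\<le>j. w i)"
    by (simp add: sum_distrib_left)
  also have "(\<Sum>i\<le>j. w i) = 1 - (1 / 2) ^ j"
    by (induction j) (auto simp: w_def)
  also have "(2 * K) ^ j * \<dots> \<le> (2 * K) ^ j"
    using K by (intro mult_left_le) auto
  finally show ?case .
qed

text \<open>
  In \<open>\<Sum>\<^sub>b\<^sub>\<le>\<^sub>j \<Sum>\<^sub>l\<^sub>\<le>\<^sub>j\<close> each of the \<open>(j + 1)\<^sup>2 \<le> 4\<^sup>j\<close> terms is at most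
  \<open>K\<^sup>a\<^sup>+\<^sup>2\<^sup>j\<^sup>+\<^sup>1 (2K)\<^sup>j\<close>.
\<close>

lemma graph_tail_nth_bound:
  assumes g: "g $ 0 = 0" and K: "K \<ge> 1"
    and bound_g: "\<And>j. norm (g $ j) \<le> K ^ j"
    and bound_F: "\<And>i j. norm (F $ i $ j) \<le> K ^ (i + j + 1)"
  shows "norm (graph_tail g F a $ j) \<le> (8 * K ^ 3) ^ (a + j + 1)"
proof -
  have "norm (graph_tail g F a $ j) \<le> (\<Sum>b\<le>j. \<Sum>l\<le>j. norm (F $ (a + b) $ l * (g ^ b) $ (j - l)))"
    unfolding graph_tail_def fps_nth_Abs_fps fps_mult_nth atMost_atLeast0[symmetric]
    by (intro order.trans[OF norm_sum] sum_mono order.refl)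
  also have "\<dots> \<le> (\<Sum>b\<le>j. \<Sum>l\<le>j. K ^ (a + 2 * j + 1) * (2 * K) ^ j)"
  proof (intro sum_mono)
    fix b l assume bl: "b \<in> {..j}" "l \<in> {..j}"
    have "norm (F $ (a + b) $ l * (g ^ b) $ (j - l)) \<le> K ^ (a + b + l + 1) * (2 * K) ^ (j - l)"
      unfolding norm_mult using K
      by (intro mult_mono bound_F fps_power_nth_bound g bound_g) auto
    also have "\<dots> \<le> K ^ (a + 2 * j + 1) * (2 * K) ^ j"
      using K bl by (intro mult_mono power_increasing) auto
    finally show "norm (F $ (a + b) $ l * (g ^ b) $ (j - l)) \<le> K ^ (a + 2 * j + 1) * (2 * K) ^ j" .
  qed
  also have "\<dots> = real (j + 1) * real (j + 1) * (K ^ (a + 3 * j + 1) * 2 ^ j)"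
    by (simp add: power_mult_distrib power_add power_mult mult_ac power3_eq_cube power2_eq_square)
  also have "\<dots> \<le> 2 ^ j * 2 ^ j * (K ^ (a + 3 * j + 1) * 2 ^ j)"
  proof -
    have "real (j + 1) \<le> 2 ^ j"
      using of_nat_mono[of "j + 1" "2 ^ j", where 'a = real] less_exp[of j] by simp
    then show ?thesis using K by (intro mult_right_mono mult_mono) auto
  qed
  also have "\<dots> = 8 ^ j * K ^ (a + 3 * j + 1)"
    by (simp flip: power_mult_distrib)
  also have "\<dots> \<le> 8 ^ (a + j + 1) * K ^ (3 * (a + j + 1))"
    using K by (intro mult_mono power_increasing) auto
  also have "\<dots> = (8 * K ^ 3) ^ (a + j + 1)"
    by (simp only: power_mult_distrib power_mult)
  finally show ?thesis .
qed

lemma graph_tail_convergent: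
  assumes g: "g $ 0 = 0" "fps_conv_radius g > 0" and F: "fps2_convergent F"
  obtains K where "K \<ge> 1" "\<And>a j. norm (graph_tail g F a $ j) \<le> K ^ (a + j + 1)"
proof -
  obtain K where K: "K \<ge> 1" "\<And>i j. norm (F $ i $ j) \<le> K ^ (i + j + 1)"
    using F unfolding fps2_convergent_iff_exponential_bound by blast
  obtain L where L: "L \<ge> 1" "\<And>i j. norm (fps_const g $ i $ j) \<le> L ^ (i + j + 1)"
    using g(2) unfolding fps2_convergent_fps_const_iff[symmetric]
      fps2_convergent_iff_exponential_bound by blast
  define M where "M = max K (L ^ 2)"
  have M: "M \<ge> 1" "M \<ge> K" "M \<ge> L ^ 2"
    using K(1) by (auto simp: M_def)
  have "norm (graph_tail g F a $ j) \<le> (8 * M ^ 3) ^ (a + j + 1)" for a j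
  proof (rule graph_tail_nth_bound[OF g(1) M(1)])
    fix j
    show "norm (g $ j) \<le> M ^ j"
    proof (cases "j = 0")
      case False
      have "norm (g $ j) \<le> L ^ (j + 1)"
        using L(2)[of 0 j] by simp
      also have "\<dots> \<le> L ^ (2 * j)"
        using L(1) False by (intro power_increasing) auto
      also have "\<dots> \<le> M ^ j"
        unfolding power_mult using M by (intro power_mono) auto
      finally show ?thesis .
    qed (simp add: g)
  next
    fix i j
    show "norm (F $ i $ j) \<le> M ^ (i + j + 1)"
      using K M by (intro order.trans[OF K(2)] power_mono) auto
  qed
  moreover have "8 * M ^ 3 \<ge> 1"
    using one_le_power[OF M(1), of 3] by linarith
  ultimately show ?thesis using that by blast
qed

lemma fps_conv_radius_graph_restrict:
  assumes "g $ 0 = 0" "fps_conv_radius g > 0" "fps2_convergent F"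
  shows "fps_conv_radius (graph_restrict g F) > 0"
proof -
  obtain K where K: "K \<ge> 1" "\<And>a j. norm (graph_tail g F a $ j) \<le> K ^ (a + j + 1)"
    using graph_tail_convergent[OF assms] by blast
  have "norm (fps_const (graph_restrict g F) $ i $ j) \<le> K ^ (i + j + 1)" for i j
    using K(1) K(2)[of 0 j] by (cases i) (auto simp: graph_restrict_def)
  then show ?thesis
    unfolding fps2_convergent_fps_const_iff[symmetric] fps2_convergent_iff_exponential_bound
    using K(1) by blast
qed

lemma fps2_convergent_graph_quotient:
  assumes "g $ 0 = 0" "fps_conv_radius g > 0" "fps2_convergent F"
  shows "fps2_convergent (graph_quotient g F)"
proof -
  obtain K where K: "K \<ge> 1" "\<And>a j. norm (graph_tail g F a $ j) \<le> K ^ (a + j + 1)"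
    using graph_tail_convergent[OF assms] by blast
  have "norm (graph_quotient g F $ i $ j) \<le> (K ^ 2) ^ (i + j + 1)" for i j
  proof -
    have "norm (graph_quotient g F $ i $ j) \<le> K ^ (Suc i + j + 1)"
      unfolding graph_quotient_def fps_nth_Abs_fps by (rule K(2))
    also have "\<dots> \<le> (K ^ 2) ^ (i + j + 1)"
      unfolding power_mult[symmetric] using K(1) by (intro power_increasing) auto
    finally show ?thesis .
  qed
  then show ?thesis
    unfolding fps2_convergent_iff_exponential_bound
    using one_le_power[OF K(1), of 2] by blast
qed


text \<open>
  Let \<open>\<bar>Q\<^sub>k\<^sub>l\<bar> \<le> \<bar>Q\<^sub>0\<^sub>0\<bar> K\<^sup>k\<^sup>+\<^sup>l\<close> for \<open>(k, l) \<noteq> (0, 0)\<close>. The recursion for the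
  coefficients of the formal inverse \<open>V\<close> then propagates the bound
  \<open>\<bar>V\<^sub>i\<^sub>j\<bar> \<le> (4K)\<^sup>i\<^sup>+\<^sup>j / \<bar>Q\<^sub>0\<^sub>0\<bar>\<close>: replacing \<open>K\<close> by \<open>4K\<close> makes the sum over all
  \<open>(k, l) \<noteq> (0, 0)\<close> at most \<open>(4/3)\<^sup>2 - 1 \<le> 1\<close>.
\<close>

lemma fps2_convergent_inverse:
  assumes Q: "fps2_convergent Q" "Q $ 0 $ 0 \<noteq> 0"
  shows "\<exists>V. fps2_convergent V \<and> Q * V = 1"
proof -
  define c where "c = Q $ 0 $ 0"
  have c: "norm c > 0" using Q(2) by (simp add: c_def)
  define V where "V = fps_right_inverse Q (inverse (Q $ 0))"
  have QV: "Q * V = 1"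
    unfolding V_def using Q(2) by (intro fps_right_inverse) (simp add: inverse_mult_eq_1')
  obtain K0 where K0: "K0 \<ge> 1" "\<And>i j. norm (Q $ i $ j) \<le> K0 ^ (i + j + 1)"
    using Q(1) unfolding fps2_convergent_iff_exponential_bound by blast
  define m where "m = max 1 (1 / norm c)"
  (* For k + l > 0 one has k + l + 1 <= 2 (k + l), which explains the square of K0, and one factor m
     compensates the factor norm c. *)
  define K where "K = K0 ^ 2 * m"
  have m: "m \<ge> 1" "norm c * m \<ge> 1"
    using c by (auto simp: m_def max_def field_simps)
  have K: "norm (Q $ k $ l) \<le> norm c * K ^ (k + l)" if "(k, l) \<noteq> (0, 0)" for k l
  proof -
    have "norm (Q $ k $ l) \<le> K0 ^ (k + l + 1) * 1"
      using K0(2) by simp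
    also have "\<dots> \<le> K0 ^ (2 * (k + l)) * (norm c * m ^ (k + l))"
    proof (rule mult_mono)
      show "K0 ^ (k + l + 1) \<le> K0 ^ (2 * (k + l))"
        using K0(1) that by (intro power_increasing) auto
      have "m ^ 1 \<le> m ^ (k + l)"
        using m(1) that by (intro power_increasing) auto
      then have "norm c * m \<le> norm c * m ^ (k + l)"
        using c by simp
      then show "1 \<le> norm c * m ^ (k + l)"
        using m(2) by linarith
    qed (use K0(1) in auto)
    also have "\<dots> = norm c * K ^ (k + l)"
      by (simp add: K_def power_mult_distrib flip: power_mult)
    finally show ?thesis .
  qed
  have "K > 0" using K0(1) m(1) by (simp add: K_def)
  have V: "norm (V $ i $ j) \<le> (4 * K) ^ (i + j) / norm c" for i j
  proof (induction "i + j" arbitrary: i j rule: less_induct)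
    case less
    define A where "A = {..i} \<times> {..j} - {(0, 0)}"
    have "(\<Sum>(k, l)\<in>{..i} \<times> {..j}. Q $ k $ l * V $ (i - k) $ (j - l)) = 1 $ i $ j"
      using arg_cong[OF QV, of "\<lambda>F. F $ i $ j"] unfolding fps2_mult_nth sum.cartesian_product .
    then have "c * V $ i $ j + (\<Sum>(k, l)\<in>A. Q $ k $ l * V $ (i - k) $ (j - l)) = 1 $ i $ j"
      unfolding A_def by (subst (asm) sum.remove[of _ "(0, 0)"]) (auto simp: c_def)
    then have eq: "c * V $ i $ j = 1 $ i $ j - (\<Sum>(k, l)\<in>A. Q $ k $ l * V $ (i - k) $ (j - l))"
      by (simp add: algebra_simps)
    have "norm (c * V $ i $ j) \<le> (4 * K) ^ (i + j)"
    proof (cases "(i, j) = (0, 0)")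
      case True
      then show ?thesis using eq by (simp add: A_def)
    next
      case False
      then have "(1 :: complex fps fps) $ i $ j = 0"
        by (cases i) auto
      then have "norm (c * V $ i $ j) \<le> (\<Sum>p\<in>A. norm (case p of (k, l) \<Rightarrow> Q $ k $ l * V $ (i - k) $ (j - l)))"
        unfolding eq by (simp add: norm_sum)
      also have "\<dots> \<le> (\<Sum>p\<in>A. (4 * K) ^ (i + j) * (case p of (k, l) \<Rightarrow> (1 / 4) ^ k * (1 / 4) ^ l))"
      proof (intro sum_mono)
        fix p assume "p \<in> A"
        moreover obtain k l where "p = (k, l)"
          by force
        ultimately have p: "p = (k, l)" "k \<le> i" "l \<le> j" "(k, l) \<noteq> (0, 0)"
          by (auto simp: A_def)
        have "norm (Q $ k $ l * V $ (i - k) $ (j - l))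
                \<le> (norm c * K ^ (k + l)) * ((4 * K) ^ (i - k + (j - l)) / norm c)"
          unfolding norm_mult using p \<open>K > 0\<close> by (intro mult_mono K less) auto
        also have "\<dots> = K ^ (k + l) * (4 * K) ^ (i - k + (j - l))"
          using c by simp
        also have "\<dots> = ((4 * K) ^ (k + l) * (1 / 4) ^ (k + l)) * (4 * K) ^ (i - k + (j - l))"
          by (simp add: power_mult_distrib power_divide)
        also have "\<dots> = (4 * K) ^ ((k + l) + (i - k + (j - l))) * (1 / 4) ^ (k + l)"
          by (simp only: power_add mult_ac)
        also have "(k + l) + (i - k + (j - l)) = i + j"
          using p by simp
        finally show "norm (case p of (k, l) \<Rightarrow> Q $ k $ l * V $ (i - k) $ (j - l))
            \<le> (4 * K) ^ (i + j) * (case p of (k, l) \<Rightarrow> (1 / 4) ^ k * (1 / 4) ^ l)"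
          by (simp add: p(1) power_add)
      qed
      also have "\<dots> = (4 * K) ^ (i + j) * (\<Sum>(k, l)\<in>A. (1 / 4) ^ k * (1 / 4) ^ l)"
        by (simp add: sum_distrib_left)
      also have "(\<Sum>(k, l)\<in>A. (1 / 4) ^ k * (1 / 4) ^ l :: real)
          = (\<Sum>(k, l)\<in>{..i} \<times> {..j}. (1 / 4) ^ k * (1 / 4) ^ l) - 1"
        unfolding A_def by (subst sum_diff1) auto
      also have "(\<Sum>(k, l)\<in>{..i} \<times> {..j}. (1 / 4) ^ k * (1 / 4) ^ l :: real)
          = (\<Sum>k\<le>i. (1 / 4) ^ k) * (\<Sum>l\<le>j. (1 / 4) ^ l)"
        by (simp add: sum_product sum.cartesian_product)
      also have "(4 * K) ^ (i + j) * (\<dots> - 1) \<le> (4 * K) ^ (i + j) * 1"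
      proof (rule mult_left_mono)
        have geo: "(\<Sum>k\<le>n. (1 / 4) ^ k :: real) \<le> 4 / 3" for n
        proof -
          have "(\<Sum>k\<le>n. (1 / 4) ^ k :: real) = 4 / 3 - (1 / 3) * (1 / 4) ^ n"
            by (induction n) auto
          then show ?thesis by simp
        qed
        have "(\<Sum>k\<le>i. (1 / 4) ^ k :: real) * (\<Sum>l\<le>j. (1 / 4) ^ l) \<le> (4 / 3) * (4 / 3)"
          by (intro mult_mono geo sum_nonneg) auto
        then show "(\<Sum>k\<le>i. (1 / 4) ^ k :: real) * (\<Sum>l\<le>j. (1 / 4) ^ l) - 1 \<le> 1"
          by simp
      qed (use \<open>K > 0\<close> in auto)
      finally show ?thesis by simp
    qed
    then show ?case
      using c by (simp add: norm_mult field_simps)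
  qed
  have "fps2_convergent V"
  proof (rule fps2_convergentI[of "1 / (4 * K)" _ "1 / norm c"])
    fix i j
    show "norm (V $ i $ j) * (1 / (4 * K)) ^ (i + j) \<le> 1 / norm c"
      using V[of i j] \<open>K > 0\<close> c by (simp add: power_divide divide_simps)
  qed (use \<open>K > 0\<close> in auto)
  then show ?thesis using QV by blast
qed

section \<open>Evaluation of convergent power series near the origin\<close>

definition summable_at :: "real \<Rightarrow> conv_fps2 \<Rightarrow> bool" where
  "summable_at r F \<longleftrightarrow>
     (\<lambda>(i, j). norm (fps2_of_conv F $ i $ j) * r ^ (i + j)) summable_on UNIV"

lemma summable_at_mono:
  assumes "summable_at r F" "0 \<le> s" "s \<le> r"
  shows "summable_at s F"
  unfolding summable_at_def
proof (rule summable_on_comparison_test)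
  show "(\<lambda>(i, j). norm (fps2_of_conv F $ i $ j) * r ^ (i + j)) summable_on UNIV"
    using assms(1) by (simp add: summable_at_def)
qed (use assms in \<open>auto intro!: mult_left_mono power_mono\<close>)

lemma summable_at_common_radius:
  obtains r where "r > 0" "summable_at r F" "summable_at r G"
proof -
  obtain s t where "s > 0" "summable_at s F" "t > 0" "summable_at t G"
    using fps2_of_conv[of F] fps2_of_conv[of G] unfolding summable_at_def fps2_convergent_def by auto
  then show ?thesis
    by (intro that[of "min s t"]) (auto intro: summable_at_mono)
qed

text \<open>
  Evaluating in \<open>y\<close> first turns a double series into a power series in \<open>x\<close>, so that the results on
  products of power series in one variable apply twice.
\<close>

definition eval_rows :: "conv_fps2 \<Rightarrow> complex \<Rightarrow> complex fps" where
  "eval_rows F y = Abs_fps (\<lambda>i. eval_fps (fps2_of_conv F $ i) y)"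

lemma summable_at_terms:
  assumes "summable_at r F" "norm x \<le> r" "norm y \<le> r"
  shows "(\<lambda>p. norm (case p of (i, j) \<Rightarrow> fps2_of_conv F $ i $ j * x ^ i * y ^ j)) summable_on UNIV"
proof (rule summable_on_comparison_test)
  show "(\<lambda>(i, j). norm (fps2_of_conv F $ i $ j) * r ^ (i + j)) summable_on UNIV"
    using assms(1) by (simp add: summable_at_def)
  fix p :: "nat \<times> nat"
  obtain i j where p: "p = (i, j)"
    by force
  have "r \<ge> 0"
    using assms(2) norm_ge_zero[of x] by linarith
  then have "norm x ^ i * norm y ^ j \<le> r ^ i * r ^ j"
    using assms(2,3) by (intro mult_mono power_mono) auto
  then show "norm (case p of (i, j) \<Rightarrow> fps2_of_conv F $ i $ j * x ^ i * y ^ j)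
      \<le> (case p of (i, j) \<Rightarrow> norm (fps2_of_conv F $ i $ j) * r ^ (i + j))"
    by (simp add: p norm_mult norm_power power_add mult.assoc mult_left_mono)
qed auto

lemma infsum_nat_eq_suminf:
  fixes f :: "nat \<Rightarrow> complex"
  assumes "f summable_on UNIV"
  shows "summable f" "infsum f UNIV = suminf f"
  using has_sum_imp_sums[OF has_sum_infsum[OF assms]] by (auto simp: sums_iff)

lemma eval_conv_fps2_sums:
  assumes F: "summable_at r F" and xy: "norm x \<le> r" "norm y \<le> r"
  shows "(\<lambda>i. eval_rows F y $ i * x ^ i) sums eval_conv_fps2 F (x, y)"
proof -
  let ?f = "\<lambda>i j. fps2_of_conv F $ i $ j * x ^ i * y ^ j"
  have summable: "(\<lambda>(i, j). ?f i j) summable_on UNIV \<times> UNIV"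
    using abs_summable_summable[OF summable_at_terms[OF assms]] by simp
  have row: "infsum (?f i) UNIV = eval_rows F y $ i * x ^ i" for i
  proof (cases "x = 0 \<and> i > 0")
    case False
    have "?f i summable_on UNIV"
      using summable_on_SigmaD1[OF summable, of i] by simp
    from infsum_nat_eq_suminf[OF this] have *: "summable (?f i)" "infsum (?f i) UNIV = suminf (?f i)" .
    have nz: "x ^ i \<noteq> 0" using False by auto
    have eq: "?f i = (\<lambda>j. x ^ i * (fps2_of_conv F $ i $ j * y ^ j))"
      by (simp add: mult_ac)
    have "summable (\<lambda>j. fps2_of_conv F $ i $ j * y ^ j)"
      using *(1) nz unfolding eq by (subst (asm) summable_cmult_iff) auto
    from suminf_mult[OF this, of "x ^ i"] show ?thesis
      using *(2) unfolding eq by (simp add: eval_rows_def eval_fps_def mult.commute)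
  qed (auto simp: power_0_left)
  have "(\<lambda>i. infsum (?f i) UNIV) summable_on UNIV"
    by (rule summable_on_Sigma_banach[OF summable])
  from has_sum_imp_sums[OF has_sum_infsum[OF this]]
  have "(\<lambda>i. infsum (?f i) UNIV) sums infsum (\<lambda>(i, j). ?f i j) (UNIV \<times> UNIV)"
    by (simp only: infsum_Sigma'_banach[OF summable])
  then show ?thesis
    by (simp add: row eval_conv_fps2_def)
qed

lemma eval_conv_fps2_eq_eval_fps:
  assumes "summable_at r F" "norm x \<le> r" "norm y \<le> r"
  shows "eval_conv_fps2 F (x, y) = eval_fps (eval_rows F y) x"
  using eval_conv_fps2_sums[OF assms] by (simp add: eval_fps_def sums_iff)

lemma fps_conv_radius_eval_rows:
  assumes "summable_at r F" "r \<ge> 0" "norm y \<le> r"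
  shows "ereal r \<le> fps_conv_radius (eval_rows F y)"
proof -
  have "summable (\<lambda>i. eval_rows F y $ i * of_real r ^ i)"
    using eval_conv_fps2_sums[OF assms(1), of "of_real r" y] assms(2,3) by (auto simp: sums_iff)
  then show ?thesis
    unfolding fps_conv_radius_def using conv_radius_geI assms(2) by fastforce
qed

lemma fps_conv_radius_row:
  assumes "summable_at r F" "r > 0"
  shows "ereal r \<le> fps_conv_radius (fps2_of_conv F $ i)"
proof -
  have "(\<lambda>(i, j). fps2_of_conv F $ i $ j * of_real r ^ i * of_real r ^ j) summable_on UNIV \<times> UNIV"
    using abs_summable_summable[OF summable_at_terms[OF assms(1)], of "of_real r" "of_real r"] assms(2)
    by simp
  then have "(\<lambda>j. fps2_of_conv F $ i $ j * of_real r ^ i * of_real r ^ j) summable_on UNIV"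
    using summable_on_SigmaD1 by fastforce
  then have "summable (\<lambda>j. of_real r ^ i * (fps2_of_conv F $ i $ j * of_real r ^ j))"
    using infsum_nat_eq_suminf(1) by (simp add: mult_ac)
  then have "summable (\<lambda>j. fps2_of_conv F $ i $ j * of_real r ^ j)"
    using assms(2) by (subst (asm) summable_cmult_iff) auto
  then show ?thesis
    unfolding fps_conv_radius_def using conv_radius_geI assms(2) by fastforce
qed

lemma eval_fps_sum:
  fixes f :: "'b \<Rightarrow> complex fps"
  assumes "\<And>i. i \<in> A \<Longrightarrow> ereal (norm z) < fps_conv_radius (f i)"
  shows "eval_fps (\<Sum>i\<in>A. f i) z = (\<Sum>i\<in>A. eval_fps (f i) z)
    \<and> ereal (norm z) < fps_conv_radius (\<Sum>i\<in>A. f i)"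
  using assms
proof (induction A rule: infinite_finite_induct)
  case (insert a A)
  then have "ereal (norm z) < min (fps_conv_radius (f a)) (fps_conv_radius (sum f A))"
    by auto
  then show ?case
    using insert less_le_trans[OF _ fps_conv_radius_add[of "f a" "sum f A"]]
    by (auto simp: eval_fps_add)
qed auto

lemma eval_rows_mult:
  assumes "summable_at r F" "summable_at r G" "norm y < r"
  shows "eval_rows (F * G) y = eval_rows F y * eval_rows G y"
proof (rule fps_ext)
  fix n
  let ?F = "fps2_of_conv F" and ?G = "fps2_of_conv G"
  have r: "r > 0" "ereal (norm y) < ereal r"
    using assms(3) norm_ge_zero[of y] by (auto intro: order.strict_trans1 simp del: norm_ge_zero)
  have rad: "ereal (norm y) < fps_conv_radius (?F $ i)" "ereal (norm y) < fps_conv_radius (?G $ i)" for i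
    using r fps_conv_radius_row[OF assms(1), of i] fps_conv_radius_row[OF assms(2), of i]
    by (metis less_le_trans)+
  have prod: "ereal (norm y) < fps_conv_radius (?F $ i * ?G $ k)" for i k
    using rad(1)[of i] rad(2)[of k] fps_conv_radius_mult[of "?F $ i" "?G $ k"]
    by (meson less_le_trans min_less_iff_conj)
  show "eval_rows (F * G) y $ n = (eval_rows F y * eval_rows G y) $ n"
    using rad prod
    by (simp add: eval_rows_def times_conv_fps2.rep_eq fps_mult_nth eval_fps_sum eval_fps_mult)
qed

lemma eval_rows_add:
  assumes "summable_at r F" "summable_at r G" "norm y < r"
  shows "eval_rows (F + G) y = eval_rows F y + eval_rows G y"
proof (rule fps_ext)
  fix i
  let ?F = "fps2_of_conv F" and ?G = "fps2_of_conv G"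
  have r: "r > 0" "ereal (norm y) < ereal r"
    using assms(3) norm_ge_zero[of y] by (auto intro: order.strict_trans1 simp del: norm_ge_zero)
  have rad: "ereal (norm y) < fps_conv_radius (?F $ i)" "ereal (norm y) < fps_conv_radius (?G $ i)"
    using r fps_conv_radius_row[OF assms(1), of i] fps_conv_radius_row[OF assms(2), of i]
    by (metis less_le_trans)+
  then show "eval_rows (F + G) y $ i = (eval_rows F y + eval_rows G y) $ i"
    by (simp add: eval_rows_def plus_conv_fps2.rep_eq eval_fps_add)
qed

lemma eventually_nhds_0_polydisc:
  fixes P :: "complex \<times> complex \<Rightarrow> bool"
  assumes "r > 0" "\<And>x y. norm x < r \<Longrightarrow> norm y < r \<Longrightarrow> P (x, y)"
  shows "\<forall>\<^sub>F z in nhds 0. P z"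
  unfolding eventually_nhds_metric
proof (intro exI conjI allI impI)
  fix z :: "complex \<times> complex" assume z: "dist z 0 < r"
  obtain x y where "z = (x, y)" by force
  then show "P z"
    using z norm_fst_le[of x y] norm_snd_le[of y x] by (auto intro!: assms(2) simp: dist_norm)
qed (use assms in auto)

lemma eventually_eval_conv_fps2_hom:
  "\<forall>\<^sub>F z in nhds 0. eval_conv_fps2 (F * G) z = eval_conv_fps2 F z * eval_conv_fps2 G z \<and>
     eval_conv_fps2 (F + G) z = eval_conv_fps2 F z + eval_conv_fps2 G z"
proof -
  obtain r where r: "r > 0" "summable_at r F" "summable_at r G"
    using summable_at_common_radius by blast
  obtain s where s: "s > 0" "summable_at s (F * G)" "summable_at s (F + G)"
    using summable_at_common_radius by blast
  show ?thesis
  proof (rule eventually_nhds_0_polydisc[of "min r s"])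
    fix x y :: complex assume xy: "norm x < min r s" "norm y < min r s"
    have "ereal (norm x) < fps_conv_radius (eval_rows F y)" "ereal (norm x) < fps_conv_radius (eval_rows G y)"
      using fps_conv_radius_eval_rows[OF r(2), of y] fps_conv_radius_eval_rows[OF r(3), of y] xy r(1)
      by (auto intro: less_le_trans[of _ "ereal r"])
    then show "eval_conv_fps2 (F * G) (x, y) = eval_conv_fps2 F (x, y) * eval_conv_fps2 G (x, y) \<and>
     eval_conv_fps2 (F + G) (x, y) = eval_conv_fps2 F (x, y) + eval_conv_fps2 G (x, y)"
      using eval_conv_fps2_eq_eval_fps[OF r(2), of x y] eval_conv_fps2_eq_eval_fps[OF r(3), of x y]
        eval_conv_fps2_eq_eval_fps[OF s(2), of x y] eval_conv_fps2_eq_eval_fps[OF s(3), of x y] xy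
        eval_rows_mult[OF r(2,3), of y] eval_rows_add[OF r(2,3), of y]
      by (simp add: eval_fps_mult eval_fps_add)
  qed (use r s in auto)
qed

lemma eval_conv_fps2_0: "eval_conv_fps2 F 0 = fps2_of_conv F $ 0 $ 0"
proof -
  obtain r where r: "r > 0" "summable_at r F"
    using summable_at_common_radius by blast
  then have "eval_conv_fps2 F (0, 0) = eval_fps (eval_rows F 0) 0"
    by (intro eval_conv_fps2_eq_eval_fps[of r]) auto
  then show ?thesis
    by (simp add: eval_fps_at_0 eval_rows_def zero_prod_def)
qed

text \<open>
  Used for the uniform convergence of \<open>x \<mapsto> F(x, y)\<close> to \<open>x \<mapsto> F(x, 0)\<close> as \<open>y \<rightarrow> 0\<close>: every
  monomial in the difference contains a factor \<open>y\<close>.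
\<close>

lemma eval_conv_fps2_lipschitz:
  assumes "r > 0" "summable_at r F"
  obtains C where "\<And>x y. norm x \<le> r \<Longrightarrow> norm y \<le> r \<Longrightarrow>
    norm (eval_conv_fps2 F (x, y) - eval_conv_fps2 F (x, 0)) \<le> C * norm y"
proof -
  let ?g = "\<lambda>(i, j). norm (fps2_of_conv F $ i $ j) * r ^ (i + j)"
  have g: "(?g has_sum infsum ?g UNIV) UNIV"
    using assms(2) unfolding summable_at_def by (rule has_sum_infsum)
  have "norm (eval_conv_fps2 F (x, y) - eval_conv_fps2 F (x, 0)) \<le> (infsum ?g UNIV / r) * norm y"
    if xy: "norm x \<le> r" "norm y \<le> r" for x y
  proof -
    let ?t = "\<lambda>y (i, j). fps2_of_conv F $ i $ j * x ^ i * y ^ j"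
    have t: "(?t w has_sum eval_conv_fps2 F (x, w)) UNIV" if "norm w \<le> r" for w
      unfolding eval_conv_fps2_def prod.case
      by (rule has_sum_infsum, rule abs_summable_summable, rule summable_at_terms[OF assms(2) xy(1) that])
    have "((\<lambda>p. ?t y p - ?t 0 p) has_sum (eval_conv_fps2 F (x, y) - eval_conv_fps2 F (x, 0))) UNIV"
      using has_sum_add[OF t[OF xy(2)] has_sum_uminusI[OF t[of 0]]] assms(1) by simp
    moreover have "((\<lambda>p. ?g p * (norm y / r)) has_sum (infsum ?g UNIV * (norm y / r))) UNIV"
      by (rule has_sum_cmult_left[OF g])
    ultimately have "norm (eval_conv_fps2 F (x, y) - eval_conv_fps2 F (x, 0)) \<le> infsum ?g UNIV * (norm y / r)"
    proof (rule norm_infsum_le)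
      fix p :: "nat \<times> nat"
      obtain i j where p: "p = (i, j)" by force
      have *: "norm (fps2_of_conv F $ i $ j) * (norm x ^ i * norm (y ^ j - 0 ^ j))
          \<le> norm (fps2_of_conv F $ i $ j) * (r ^ i * (r ^ j * (norm y / r)))"
      proof (intro mult_left_mono mult_mono power_mono)
        show "norm (y ^ j - 0 ^ j) \<le> r ^ j * (norm y / r)"
        proof (cases j)
          case (Suc k)
          have "norm y ^ k * norm y \<le> r ^ k * norm y"
            using xy by (intro mult_right_mono power_mono) auto
          then show ?thesis using assms(1) by (simp add: Suc norm_mult norm_power mult_ac)
        qed (use assms(1) in simp)
      qed (use assms(1) xy in auto)
      have "?t y p - ?t 0 p = fps2_of_conv F $ i $ j * (x ^ i * (y ^ j - 0 ^ j))"
        by (simp add: p algebra_simps)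
      then show "norm (?t y p - ?t 0 p) \<le> ?g p * (norm y / r)"
        using * by (simp add: p norm_mult norm_power power_add mult_ac)
    qed
    then show ?thesis by simp
  qed
  then show ?thesis using that by blast
qed

lemma holomorphic_eval_conv_fps2:
  assumes "r > 0" "summable_at r F" "norm y \<le> r"
  shows "(\<lambda>x. eval_conv_fps2 F (x, y)) holomorphic_on ball 0 r"
proof -
  have "eval_fps (eval_rows F y) holomorphic_on ball 0 r"
  proof (rule holomorphic_on_eval_fps)
    show "ball 0 r \<subseteq> eball 0 (fps_conv_radius (eval_rows F y))"
      using less_le_trans[OF _ fps_conv_radius_eval_rows[OF assms(2) _ assms(3)]] assms(1)
      by (auto simp: in_eball_iff)
  qed
  then show ?thesis
    by (rule holomorphic_transform) (auto simp: eval_conv_fps2_eq_eval_fps[OF assms(2) _ assms(3)])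
qed

text \<open>
  If the origin were an isolated zero of \<open>F\<close>, then for small \<open>y \<noteq> 0\<close> the function \<open>x \<mapsto> F(x, y)\<close> would
  have no zero in a fixed disc. These functions converge uniformly to \<open>x \<mapsto> F(x, 0)\<close> as \<open>y \<rightarrow> 0\<close>, and by
  Hurwitz's theorem the limit would not vanish at \<open>0\<close> either, unless it is constant; but then it
  is zero and the origin is not isolated.
\<close>

lemma eval_conv_fps2_zeros_not_isolated:
  assumes F: "fps2_of_conv F $ 0 $ 0 = 0"
    and P: "\<forall>\<^sub>F z in nhds 0. eval_conv_fps2 F z = 0 \<longrightarrow> z = 0"
  shows False
proof -
  obtain \<delta> where \<delta>: "\<delta> > 0" "\<And>z. dist z 0 < \<delta> \<Longrightarrow> eval_conv_fps2 F z = 0 \<Longrightarrow> z = 0"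
    using P unfolding eventually_nhds_metric by blast
  obtain r0 where r0: "r0 > 0" "summable_at r0 F"
    using summable_at_common_radius by blast
  define r where "r = min r0 (\<delta> / 3)"
  have r: "r > 0" "summable_at r F" "r < \<delta> / 2"
    using r0 \<delta>(1) by (auto simp: r_def intro: summable_at_mono)
  have zero: "x = 0 \<and> y = 0" if "norm x < r" "norm y < r" "eval_conv_fps2 F (x, y) = 0" for x y
  proof -
    have "dist (x, y) 0 < \<delta>"
      using that r norm_Pair_le[of x y] by (simp add: dist_norm)
    then show ?thesis using \<delta>(2)[of "(x, y)"] that by (auto simp: zero_prod_def)
  qed
  have F0: "eval_conv_fps2 F (0, 0) = 0"
    using eval_conv_fps2_0[of F] F by (simp add: zero_prod_def)
  obtain C where C: "\<And>x y. norm x \<le> r \<Longrightarrow> norm y \<le> r \<Longrightarrow>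
    norm (eval_conv_fps2 F (x, y) - eval_conv_fps2 F (x, 0)) \<le> C * norm y"
    using eval_conv_fps2_lipschitz[OF r(1,2)] by blast
  (* A sequence in the punctured disc of radius r that tends to zero. *)
  define y where "y n = complex_of_real (r / 2 * inverse (real (Suc n)))" for n
  have norm_y: "norm (y n) = r / 2 * inverse (real (Suc n))" for n
    unfolding y_def norm_of_real using r(1) by simp
  have y: "norm (y n) < r" "y n \<noteq> 0" for n
  proof -
    have "inverse (real (Suc n)) \<le> 1" "inverse (real (Suc n)) > 0"
      by (simp_all add: field_simps)
    then have "norm (y n) \<le> r / 2 * 1" "norm (y n) > 0"
      unfolding norm_y using r(1) by (intro mult_left_mono mult_pos_pos; simp)+
    then show "norm (y n) < r" "y n \<noteq> 0"
      using r(1) by auto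
  qed
  have "eval_conv_fps2 F (0, 0) \<noteq> 0"
  proof (rule Hurwitz_no_zeros[of "ball 0 r" "\<lambda>n x. eval_conv_fps2 F (x, y n)" "\<lambda>x. eval_conv_fps2 F (x, 0)"])
    show "(\<lambda>x. eval_conv_fps2 F (x, y n)) holomorphic_on ball 0 r" for n
      using y(1)[of n] by (intro holomorphic_eval_conv_fps2 r) auto
    show "(\<lambda>x. eval_conv_fps2 F (x, 0)) holomorphic_on ball 0 r"
      using r by (intro holomorphic_eval_conv_fps2 r) auto
    show "uniform_limit K (\<lambda>n x. eval_conv_fps2 F (x, y n)) (\<lambda>x. eval_conv_fps2 F (x, 0)) sequentially"
      if "compact K" "K \<subseteq> ball 0 r" for K
    proof (rule uniform_limitI)
      fix e :: real assume e: "e > 0"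
      have "(\<lambda>n. C * norm (y n)) \<longlonglongrightarrow> C * (r / 2 * 0)"
        unfolding norm_y by (intro tendsto_intros LIMSEQ_inverse_real_of_nat)
      then have "\<forall>\<^sub>F n in sequentially. C * norm (y n) < e"
        using e by (auto elim: order_tendstoD)
      then show "\<forall>\<^sub>F n in sequentially. \<forall>x\<in>K. dist (eval_conv_fps2 F (x, y n)) (eval_conv_fps2 F (x, 0)) < e"
      proof eventually_elim
        case (elim n)
        show ?case
        proof
          fix x assume "x \<in> K"
          then have "norm x \<le> r" using that by auto
          then show "dist (eval_conv_fps2 F (x, y n)) (eval_conv_fps2 F (x, 0)) < e"
            using C[of x "y n"] y(1)[of n] elim by (simp add: dist_norm)
        qed
      qed
    qed
    show "\<not> (\<lambda>x. eval_conv_fps2 F (x, 0)) constant_on ball 0 r"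
    proof
      assume "(\<lambda>x. eval_conv_fps2 F (x, 0)) constant_on ball 0 r"
      then obtain c where c: "\<And>x. x \<in> ball 0 r \<Longrightarrow> eval_conv_fps2 F (x, 0) = c"
        by (auto simp: constant_on_def)
      have "eval_conv_fps2 F (of_real (r / 2), 0) = 0"
        using c[of 0] c[of "of_real (r / 2)"] F0 r(1) by (auto simp: norm_divide)
      then show False
        using zero[of "of_real (r / 2)" 0] r(1) by (auto simp: norm_divide)
    qed
    show "eval_conv_fps2 F (x, y n) \<noteq> 0" if "x \<in> ball 0 r" for n x
      using zero[of x "y n"] that y[of n] by auto
  qed (use r in auto)
  then show False using F0 by simp
qed

section \<open>Local equations of graph germs\<close>

definition vanishing_convergent :: "complex fps \<Rightarrow> bool" where
  "vanishing_convergent g \<longleftrightarrow> g $ 0 = 0 \<and> fps_conv_radius g > 0"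

definition series_in_y :: "complex fps \<Rightarrow> conv_fps2" where
  "series_in_y u = conv_of_fps2 (fps_const u)"

definition graph_equation :: "complex fps \<Rightarrow> conv_fps2" where
  "graph_equation g = conv_of_fps2 (fps_X - fps_const g)"

definition restrict_to_graph :: "complex fps \<Rightarrow> conv_fps2 \<Rightarrow> complex fps" where
  "restrict_to_graph g F = graph_restrict g (fps2_of_conv F)"

lemma fps2_of_conv_series_in_y:
  assumes "fps_conv_radius u > 0"
  shows "fps2_of_conv (series_in_y u) = fps_const u"
  using assms by (simp add: series_in_y_def conv_of_fps2_inverse fps2_convergent_fps_const_iff)

lemma fps2_convergent_X: "fps2_convergent fps_X"
  by (rule fps2_convergentI[of 1 _ 1]) (auto simp: fps_X_nth)

lemma fps2_of_conv_graph_equation: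
  assumes "fps_conv_radius g > 0"
  shows "fps2_of_conv (graph_equation g) = fps_X - fps_const g"
proof -
  have "fps2_convergent (fps_X + - fps_const g)"
    using assms by (intro fps2_convergent_add fps2_convergent_uminus fps2_convergent_X)
      (simp add: fps2_convergent_fps_const_iff)
  then have "fps2_convergent (fps_X - fps_const g)"
    unfolding diff_conv_add_uminus .
  then show ?thesis
    by (simp add: graph_equation_def conv_of_fps2_inverse)
qed

lemma series_in_y_mult:
  assumes "fps_conv_radius u > 0" "fps_conv_radius v > 0"
  shows "series_in_y (u * v) = series_in_y u * series_in_y v"
proof -
  have "fps_conv_radius (u * v) > 0"
    using assms less_le_trans[OF _ fps_conv_radius_mult[of u v]] by auto
  then show ?thesis
    using assms by (simp add: fps2_of_conv_inject[symmetric] times_conv_fps2.rep_eq fps2_of_conv_series_in_y)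
qed

lemma restrict_to_graph_add:
  assumes "vanishing_convergent g"
  shows "restrict_to_graph g (F + G) = restrict_to_graph g F + restrict_to_graph g G"
  using assms by (simp add: restrict_to_graph_def plus_conv_fps2.rep_eq graph_restrict_add vanishing_convergent_def)

lemma restrict_to_graph_mult:
  assumes "vanishing_convergent g"
  shows "restrict_to_graph g (F * G) = restrict_to_graph g F * restrict_to_graph g G"
  using assms by (simp add: restrict_to_graph_def times_conv_fps2.rep_eq graph_restrict_mult vanishing_convergent_def)

lemma restrict_to_graph_1 [simp]: "vanishing_convergent g \<Longrightarrow> restrict_to_graph g 1 = 1"
  using graph_restrict_const[of g 1]
  by (simp add: restrict_to_graph_def one_conv_fps2.rep_eq vanishing_convergent_def)

lemma restrict_to_graph_graph_equation:
  assumes "vanishing_convergent g" "vanishing_convergent h"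
  shows "restrict_to_graph g (graph_equation h) = g - h"
  using assms by (simp add: restrict_to_graph_def fps2_of_conv_graph_equation
      graph_restrict_graph_equation vanishing_convergent_def)

lemma restrict_to_graph_series_in_y:
  assumes "vanishing_convergent g" "fps_conv_radius u > 0"
  shows "restrict_to_graph g (series_in_y u) = u"
  using assms by (simp add: restrict_to_graph_def fps2_of_conv_series_in_y vanishing_convergent_def)

lemma fps_conv_radius_restrict_to_graph:
  assumes "vanishing_convergent g"
  shows "fps_conv_radius (restrict_to_graph g F) > 0"
  using assms fps2_of_conv[of F]
  by (auto simp: restrict_to_graph_def vanishing_convergent_def intro: fps_conv_radius_graph_restrict)

lemma division_by_graph_equation:
  assumes g: "vanishing_convergent g"
  obtains Q where "F = series_in_y (restrict_to_graph g F) + graph_equation g * Q"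
proof
  have "fps2_convergent (graph_quotient g (fps2_of_conv F))"
    using g fps2_of_conv[of F] by (auto simp: vanishing_convergent_def intro: fps2_convergent_graph_quotient)
  then have Q: "fps2_of_conv (conv_of_fps2 (graph_quotient g (fps2_of_conv F))) = graph_quotient g (fps2_of_conv F)"
    by (simp add: conv_of_fps2_inverse)
  show "F = series_in_y (restrict_to_graph g F)
      + graph_equation g * conv_of_fps2 (graph_quotient g (fps2_of_conv F))"
    unfolding fps2_of_conv_inject[symmetric] plus_conv_fps2.rep_eq times_conv_fps2.rep_eq Q
      fps2_of_conv_series_in_y[OF fps_conv_radius_restrict_to_graph[OF g]]
    using g graph_division[of g "fps2_of_conv F"]
    by (simp add: fps2_of_conv_graph_equation vanishing_convergent_def restrict_to_graph_def)
qed

text \<open>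
  So \<open>x - g(y)\<close> generates the kernel of a homomorphism to an integral domain: it is a prime element.
\<close>

lemma graph_equation_dvd_iff:
  assumes g: "vanishing_convergent g"
  shows "graph_equation g dvd F \<longleftrightarrow> restrict_to_graph g F = 0"
proof
  assume "graph_equation g dvd F"
  then show "restrict_to_graph g F = 0"
    using g by (auto simp: restrict_to_graph_mult restrict_to_graph_graph_equation)
next
  assume "restrict_to_graph g F = 0"
  moreover have "series_in_y 0 = 0"
    by (simp add: series_in_y_def zero_conv_fps2_def)
  ultimately show "graph_equation g dvd F"
    using division_by_graph_equation[OF g, of F] by (metis add_0 dvd_triv_left)
qed

lemma conv_fps2_unit_if_nonzero:
  assumes "fps2_of_conv F $ 0 $ 0 \<noteq> 0"
  shows "F dvd 1"
proof -
  obtain V where V: "fps2_convergent V" "fps2_of_conv F * V = 1"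
    using fps2_convergent_inverse[OF _ assms] fps2_of_conv[of F] by auto
  have "F * conv_of_fps2 V = 1"
    unfolding fps2_of_conv_inject[symmetric] times_conv_fps2.rep_eq one_conv_fps2.rep_eq
    using V by (simp add: conv_of_fps2_inverse)
  then show ?thesis by (metis dvd_triv_left)
qed

lemma graph_equation_nonunit:
  assumes g: "vanishing_convergent g"
  shows "\<not> graph_equation g dvd 1"
  using g by (simp add: graph_equation_dvd_iff)

text \<open>
  As a prime element, \<open>x - g(y)\<close> divides one factor of \<open>A\<^sup>2 B = x - g(y)\<close>, and cancelling it turns
  the remaining factors into units.
\<close>

lemma squarefree_graph_equation:
  assumes g: "vanishing_convergent g"
  shows "squarefree (graph_equation g)"
proof (rule squarefreeI)
  fix A assume "A ^ 2 dvd graph_equation g"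
  then obtain B where AB: "graph_equation g = A * A * B"
    by (auto simp: power2_eq_square)
  have nz: "graph_equation g \<noteq> 0"
  proof
    assume "graph_equation g = 0"
    then have "fps2_of_conv (graph_equation g) $ 1 $ 0 = 0"
      by (simp add: zero_conv_fps2.rep_eq)
    then show False
      using g by (simp add: fps2_of_conv_graph_equation vanishing_convergent_def)
  qed
  have "restrict_to_graph g A * restrict_to_graph g A * restrict_to_graph g B = 0"
    using AB g by (metis dvd_refl graph_equation_dvd_iff restrict_to_graph_mult)
  then have "graph_equation g dvd A \<or> graph_equation g dvd B"
    using g by (auto simp: graph_equation_dvd_iff)
  then show "A dvd 1"
  proof
    assume "graph_equation g dvd A"
    then obtain A' where A': "A = graph_equation g * A'" by blast
    have "graph_equation g * (A' * A * B) = (graph_equation g * A') * A * B"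
      by (simp only: mult.assoc)
    also have "\<dots> = graph_equation g * 1"
      by (simp only: A'[symmetric] AB[symmetric] mult_1_right)
    finally have "A' * A * B = 1" using nz by (simp only: mult_cancel_left) simp
    then show "A dvd 1" by (metis dvd_triv_left mult.assoc mult.commute)
  next
    assume "graph_equation g dvd B"
    then obtain B' where B': "B = graph_equation g * B'" by blast
    have "graph_equation g * (A * A * B') = A * A * (graph_equation g * B')"
      by (simp only: mult_ac)
    also have "\<dots> = graph_equation g * 1"
      by (simp only: B'[symmetric] AB[symmetric] mult_1_right)
    finally have "A * A * B' = 1" using nz by (simp only: mult_cancel_left) simp
    then show "A dvd 1" by (metis dvd_triv_left mult.assoc)
  qed
qed

lemma eventually_eval_series_in_y:
  assumes "fps_conv_radius u > 0"
  shows "\<forall>\<^sub>F z in nhds 0. eval_conv_fps2 (series_in_y u) z = eval_fps u (snd z)"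
proof -
  obtain r where r: "r > 0" "summable_at r (series_in_y u)"
    using summable_at_common_radius by blast
  have rows: "eval_rows (series_in_y u) y = fps_const (eval_fps u y)" for y
    using assms by (intro fps_ext) (auto simp: eval_rows_def fps2_of_conv_series_in_y)
  show ?thesis
    by (rule eventually_nhds_0_polydisc[OF r(1)])
      (simp add: eval_conv_fps2_eq_eval_fps[OF r(2)] rows)
qed

lemma eventually_eval_graph_equation:
  assumes "fps_conv_radius g > 0"
  shows "\<forall>\<^sub>F z in nhds 0. eval_conv_fps2 (graph_equation g) z = fst z - eval_fps g (snd z)"
proof -
  obtain r where r: "r > 0" "summable_at r (graph_equation g)"
    using summable_at_common_radius by blast
  have rows: "eval_rows (graph_equation g) y = fps_X - fps_const (eval_fps g y)"
    if "ereal (norm y) < fps_conv_radius g" for y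
  proof (rule fps_ext)
    fix i
    show "eval_rows (graph_equation g) y $ i = (fps_X - fps_const (eval_fps g y)) $ i"
      using assms eval_fps_diff[of y 0 g] that
      by (auto simp: eval_rows_def fps2_of_conv_graph_equation fps_X_nth eval_fps_diff)
  qed
  obtain s where s: "s > 0" "ereal s < fps_conv_radius g"
    using assms ereal_dense2 by (metis ereal_less(2) zero_ereal_def)
  show ?thesis
  proof (rule eventually_nhds_0_polydisc[of "min r s"])
    fix x y :: complex assume xy: "norm x < min r s" "norm y < min r s"
    then have "ereal (norm y) < fps_conv_radius g"
      using s(2) by (auto intro: order.strict_trans[of _ "ereal s"])
    then show "eval_conv_fps2 (graph_equation g) (x, y) = fst (x, y) - eval_fps g (snd (x, y))"
      using xy by (simp add: eval_conv_fps2_eq_eval_fps[OF r(2)] rows eval_fps_diff)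
  qed (use r s in auto)
qed

definition graph_germ :: "complex fps \<Rightarrow> set_germ" where
  "graph_germ g = germ {z. fst z = eval_fps g (snd z)}"

lemma germ_eq_iff: "germ A = germ B \<longleftrightarrow> (\<forall>\<^sub>F z in nhds 0. z \<in> A \<longleftrightarrow> z \<in> B)"
  by transfer simp

lemma reduced_local_equation_graph_equation:
  assumes g: "vanishing_convergent g"
  shows "reduced_local_equation (graph_equation g) (graph_germ g)"
proof -
  have "eval_conv_fps2 (graph_equation g) 0 = 0"
    using g by (simp add: eval_conv_fps2_0 fps2_of_conv_graph_equation vanishing_convergent_def)
  moreover have "graph_germ g = germ {z. eval_conv_fps2 (graph_equation g) z = 0}"
    unfolding graph_germ_def germ_eq_iff
    by (rule eventually_mono[OF eventually_eval_graph_equation[of g]])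
      (use g in \<open>auto simp: vanishing_convergent_def\<close>)
  ultimately show ?thesis
    using squarefree_graph_equation[OF g] by (simp add: reduced_local_equation_def)
qed

lemma eventually_on_graph:
  assumes g: "vanishing_convergent g" and P: "\<forall>\<^sub>F z in nhds 0. P z"
  shows "\<forall>\<^sub>F y in nhds 0. P (eval_fps g y, y)"
proof -
  have "isCont (eval_fps g) 0"
    using g by (intro continuous_eval_fps) (simp add: vanishing_convergent_def flip: zero_ereal_def)
  then have "isCont (\<lambda>y. (eval_fps g y, y)) 0"
    by (intro continuous_Pair continuous_ident)
  then have "filterlim (\<lambda>y. (eval_fps g y, y)) (nhds (eval_fps g 0, 0)) (nhds 0)"
    using tendsto_at_iff_tendsto_nhds[of "\<lambda>y. (eval_fps g y, y)" 0] by (simp add: isCont_def)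
  moreover have "(eval_fps g 0, 0) = (0 :: complex \<times> complex)"
    using g by (simp add: eval_fps_at_0 vanishing_convergent_def zero_prod_def)
  ultimately show ?thesis
    using P by (auto simp: filterlim_iff)
qed

text \<open>
  The formal restriction is the analytic one: evaluate both sides of the division by \<open>x - g(y)\<close> at
  the points of the graph.
\<close>

lemma eventually_eval_on_graph:
  assumes g: "vanishing_convergent g"
  shows "\<forall>\<^sub>F y in nhds 0. eval_conv_fps2 F (eval_fps g y, y) = eval_fps (restrict_to_graph g F) y"
proof -
  let ?R = "series_in_y (restrict_to_graph g F)"
  obtain Q where Q: "F = ?R + graph_equation g * Q"
    using division_by_graph_equation[OF g] by blast
  have radius_g: "fps_conv_radius g > 0"
    using g by (simp add: vanishing_convergent_def)
  note radius = fps_conv_radius_restrict_to_graph[OF g, of F]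
  have "\<forall>\<^sub>F z in nhds 0. eval_conv_fps2 F z =
     eval_fps (restrict_to_graph g F) (snd z) + (fst z - eval_fps g (snd z)) * eval_conv_fps2 Q z"
    using eventually_eval_conv_fps2_hom[of ?R "graph_equation g * Q"]
      eventually_eval_conv_fps2_hom[of "graph_equation g" Q] eventually_eval_series_in_y[OF radius]
      eventually_eval_graph_equation[OF radius_g]
    unfolding Q[symmetric] by eventually_elim simp
  from eventually_on_graph[OF g this] show ?thesis
    by eventually_elim simp
qed

lemma eventually_eval_fps_nonzero:
  assumes "fps_conv_radius u > 0" "u \<noteq> 0"
  shows "\<forall>\<^sub>F y in at 0. eval_fps u y \<noteq> (0 :: complex)"
proof -
  have "eval_fps u has_fps_expansion u"
    using assms(1) by (simp add: has_fps_expansion_def)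
  then have "eval_fps u has_laurent_expansion fps_to_fls u"
    by (rule has_laurent_expansion_fps)
  then show ?thesis
    by (rule has_laurent_expansion_nonzero_imp_eventually_nonzero) (use assms(2) in simp)
qed

text \<open>
  An equation \<open>F\<close> of the graph vanishes on it, hence \<open>F = (x - g(y)) U\<close>. Squarefreeness prevents
  \<open>U\<close> from vanishing identically on the graph, so on the graph the origin is an isolated zero of
  \<open>U\<close>. Off the graph \<open>F\<close> and hence \<open>U\<close> have no zeros at all. Therefore the origin cannot be a zero
  of \<open>U\<close>, as it would be an isolated one.
\<close>

theorem reduced_local_equation_graph_germ_unique:
  assumes g: "vanishing_convergent g" and F: "reduced_local_equation F (graph_germ g)"
  obtains U where "U dvd 1" "F = graph_equation g * U"
proof -
  have zeros: "\<forall>\<^sub>F z in nhds 0. fst z = eval_fps g (snd z) \<longleftrightarrow> eval_conv_fps2 F z = 0"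
    using F by (simp add: reduced_local_equation_def graph_germ_def germ_eq_iff)
  have "\<forall>\<^sub>F y in nhds 0. eval_fps (restrict_to_graph g F) y = 0"
    using eventually_on_graph[OF g zeros] eventually_eval_on_graph[OF g, of F]
    by eventually_elim simp
  then have "\<forall>\<^sub>F y in at 0. eval_fps (restrict_to_graph g F) y = 0"
    by (simp add: eventually_nhds_conv_at)
  then have "restrict_to_graph g F = 0"
  proof (rule contrapos_pp)
    assume "restrict_to_graph g F \<noteq> 0"
    from eventually_eval_fps_nonzero[OF fps_conv_radius_restrict_to_graph[OF g] this]
    show "\<not> (\<forall>\<^sub>F y in at 0. eval_fps (restrict_to_graph g F) y = 0)"
      using eventually_elim2[of _ "at (0 :: complex)" _ "\<lambda>_. False"] by auto
  qed
  then obtain U where U: "F = graph_equation g * U"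
    using graph_equation_dvd_iff[OF g] by blast
  have nz: "restrict_to_graph g U \<noteq> 0"
  proof
    assume "restrict_to_graph g U = 0"
    then have "graph_equation g ^ 2 dvd F"
      using graph_equation_dvd_iff[OF g] by (simp add: U power2_eq_square)
    moreover have "squarefree F"
      using F by (simp add: reduced_local_equation_def)
    ultimately show False
      using graph_equation_nonunit[OF g] squarefreeD by blast
  qed
  have "fps2_of_conv U $ 0 $ 0 \<noteq> 0"
  proof
    assume U0: "fps2_of_conv U $ 0 $ 0 = 0"
    have "\<forall>\<^sub>F y in nhds 0. eval_fps (restrict_to_graph g U) y = 0 \<longrightarrow> y = 0"
      using eventually_eval_fps_nonzero[OF fps_conv_radius_restrict_to_graph[OF g] nz]
      unfolding eventually_at_filter by (rule eventually_mono) blast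
    then have ev: "\<forall>\<^sub>F y in nhds 0. eval_conv_fps2 U (eval_fps g y, y) = 0 \<longrightarrow> y = 0"
      using eventually_eval_on_graph[OF g, of U] by eventually_elim simp
    have lim: "filterlim snd (nhds (0 :: complex)) (nhds (0 :: complex \<times> complex))"
      using tendsto_snd[OF tendsto_ident_at, of "0 :: complex \<times> complex" UNIV]
        tendsto_at_iff_tendsto_nhds[of snd "0 :: complex \<times> complex"] by simp
    have "\<forall>\<^sub>F z in nhds (0 :: complex \<times> complex). eval_conv_fps2 U (eval_fps g (snd z), snd z) = 0 \<longrightarrow> snd z = (0 :: complex)"
      using eventually_compose_filterlim[OF ev lim] .
    then have "\<forall>\<^sub>F z in nhds 0. eval_conv_fps2 U z = 0 \<longrightarrow> z = 0"
      using zeros eventually_eval_conv_fps2_hom[of "graph_equation g" U]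
    proof eventually_elim
      case (elim z)
      show ?case
      proof
        assume "eval_conv_fps2 U z = 0"
        with elim have z: "fst z = eval_fps g (snd z)"
          by (simp add: U)
        then have "eval_conv_fps2 U (eval_fps g (snd z), snd z) = 0"
          using \<open>eval_conv_fps2 U z = 0\<close> by (metis prod.collapse)
        with elim have "snd z = 0"
          by blast
        moreover from this have "fst z = 0"
          using z g by (simp add: eval_fps_at_0 vanishing_convergent_def)
        ultimately show "z = 0"
          by (simp add: prod_eq_iff)
      qed
    qed
    then show False
      using eval_conv_fps2_zeros_not_isolated U0 by blast
  qed
  then show ?thesis
    using that U conv_fps2_unit_if_nonzero by blast
qed

section \<open>Intersection multiplicity of two graphs\<close>

abbreviation conv_ring :: "conv_fps2 ring" where
  "conv_ring \<equiv> ring_of_type_algebra"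

lemma ring_of_type_algebra_simps:
  fixes x y :: "'a :: comm_ring_1"
  shows "carrier (ring_of_type_algebra :: 'a ring) = UNIV"
    and "x \<otimes>\<^bsub>ring_of_type_algebra\<^esub> y = x * y"
    and "x \<oplus>\<^bsub>ring_of_type_algebra\<^esub> y = x + y"
    and "\<one>\<^bsub>ring_of_type_algebra\<^esub> = (1 :: 'a)"
    and "\<zero>\<^bsub>ring_of_type_algebra\<^esub> = (0 :: 'a)"
    and "\<ominus>\<^bsub>ring_of_type_algebra\<^esub> x = - x"
    and "x \<ominus>\<^bsub>ring_of_type_algebra\<^esub> y = x - y"
proof -
  interpret cring "ring_of_type_algebra :: 'a ring"
    by (rule cring_from_type_algebra)
  show *: "carrier (ring_of_type_algebra :: 'a ring) = UNIV"
    "x \<otimes>\<^bsub>ring_of_type_algebra\<^esub> y = x * y"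
    "x \<oplus>\<^bsub>ring_of_type_algebra\<^esub> y = x + y"
    "\<one>\<^bsub>ring_of_type_algebra\<^esub> = (1 :: 'a)"
    "\<zero>\<^bsub>ring_of_type_algebra\<^esub> = (0 :: 'a)" for x y :: 'a
    by (simp_all add: ring_of_type_algebra_def)
  show neg: "\<ominus>\<^bsub>ring_of_type_algebra\<^esub> x = - x" for x :: 'a
    by (rule minus_equality) (simp_all add: *)
  show "x \<ominus>\<^bsub>ring_of_type_algebra\<^esub> y = x - y"
    by (simp add: a_minus_def neg *)
qed

lemma genideal_pair:
  "genideal conv_ring {F, G} = {A * F + B * G | A B. True}" (is "_ = ?I")
proof
  interpret cring conv_ring
    by (rule cring_from_type_algebra)
  note simps = ring_of_type_algebra_simps[where 'a = conv_fps2]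
  have "ideal ?I conv_ring"
  proof (rule idealI)
    show "subgroup ?I (add_monoid conv_ring)"
    proof (rule add.subgroupI)
      show "?I \<noteq> {}" by blast
    next
      fix a assume "a \<in> ?I"
      then obtain A B where "a = A * F + B * G" by blast
      then have "\<ominus>\<^bsub>conv_ring\<^esub> a = (- A) * F + (- B) * G"
        by (simp add: simps)
      then show "\<ominus>\<^bsub>conv_ring\<^esub> a \<in> ?I" by blast
    next
      fix a b assume "a \<in> ?I" "b \<in> ?I"
      then obtain A B A' B' where "a = A * F + B * G" "b = A' * F + B' * G" by blast
      then have "a \<oplus>\<^bsub>conv_ring\<^esub> b = (A + A') * F + (B + B') * G"
        by (simp add: simps algebra_simps)
      then show "a \<oplus>\<^bsub>conv_ring\<^esub> b \<in> ?I" by blast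
    qed (simp add: simps)
  next
    fix a x assume "a \<in> ?I"
    then obtain A B where "a = A * F + B * G" by blast
    then have "x * a = (x * A) * F + (x * B) * G"
      by (simp add: algebra_simps)
    then have "x * a \<in> ?I" by blast
    then show "x \<otimes>\<^bsub>conv_ring\<^esub> a \<in> ?I" "a \<otimes>\<^bsub>conv_ring\<^esub> x \<in> ?I"
      by (simp_all only: simps mult.commute[of a])
  qed (rule ring_axioms)
  moreover have "{F, G} \<subseteq> ?I"
  proof -
    have "F = 1 * F + 0 * G" "G = 0 * F + 1 * G" by simp_all
    then show ?thesis by blast
  qed
  ultimately show "genideal conv_ring {F, G} \<subseteq> ?I"
    by (rule genideal_minimal)
  interpret J: ideal "genideal conv_ring {F, G}" conv_ring
    by (rule genideal_ideal) (simp add: simps)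
  have "F \<in> genideal conv_ring {F, G}" "G \<in> genideal conv_ring {F, G}"
    using genideal_self[of "{F, G}"] by (auto simp: simps)
  then have "A * F + B * G \<in> genideal conv_ring {F, G}" for A B
    using J.I_l_closed[of F A] J.I_l_closed[of G B] J.a_closed by (simp add: simps)
  then show "?I \<subseteq> genideal conv_ring {F, G}" by blast
qed

lemma series_in_y_diff_graph_equations:
  assumes "vanishing_convergent g" "vanishing_convergent h"
  shows "series_in_y (g - h) = graph_equation h - graph_equation g"
proof -
  have "fps_conv_radius (g - h) > 0"
    using assms less_le_trans[OF _ fps_conv_radius_diff[of g h]] by (auto simp: vanishing_convergent_def)
  then show ?thesis
    using assms by (simp add: fps2_of_conv_inject[symmetric] minus_conv_fps2.rep_eq
      fps2_of_conv_series_in_y fps2_of_conv_graph_equation vanishing_convergent_def flip: fps_const_sub)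
qed

text \<open>
  The ideal is the kernel of \<open>F \<mapsto> F(g(y), y) mod y\<^sup>d\<close>, \<open>d\<close> being the order of \<open>g - h\<close>: modulo
  \<open>x - g(y)\<close> every \<open>F\<close> is congruent to its restriction, and the second generator becomes
  \<open>g - h\<close>, which is \<open>y\<^sup>d\<close> times a unit.
\<close>

lemma ideal_of_two_graphs:
  assumes g: "vanishing_convergent g" and h: "vanishing_convergent h" and "g \<noteq> h"
    and U: "U dvd 1" and V: "V dvd 1"
  shows "genideal conv_ring {graph_equation g * U, graph_equation h * V}
           = {F. \<forall>j < subdegree (g - h). restrict_to_graph g F $ j = 0}"
proof (intro equalityI subsetI)
  fix F assume "F \<in> genideal conv_ring {graph_equation g * U, graph_equation h * V}"
  then obtain A B where F: "F = A * (graph_equation g * U) + B * (graph_equation h * V)"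
    by (auto simp: genideal_pair)
  have "restrict_to_graph g F = (g - h) * (restrict_to_graph g B * restrict_to_graph g V)"
    unfolding F using g h
    by (simp add: restrict_to_graph_add restrict_to_graph_mult restrict_to_graph_graph_equation mult_ac)
  then show "F \<in> {F. \<forall>j < subdegree (g - h). restrict_to_graph g F $ j = 0}"
    by (simp add: fps_mult_nth_outside_subdegrees)
next
  fix F assume F: "F \<in> {F. \<forall>j < subdegree (g - h). restrict_to_graph g F $ j = 0}"
  define d where "d = subdegree (g - h)"
  define u where "u = restrict_to_graph g F"
  (* g - h = y^d e with e a unit, so T is the quotient of u by g - h. *)
  define e where "e = fps_shift d (g - h)"
  define T where "T = fps_shift d u * inverse e"
  have e: "g - h = e * fps_X ^ d" "e $ 0 \<noteq> 0"
    using \<open>g \<noteq> h\<close> nth_subdegree_nonzero[of "g - h"] unfolding e_def d_def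
    by (simp_all add: fps_shift_times_fps_X_power del: nth_subdegree_zero_iff fps_sub_nth)
  have "u = fps_shift d u * fps_X ^ d"
  proof (cases "u = 0")
    case False
    then have "d \<le> subdegree u"
      using F by (intro subdegree_geI) (auto simp: u_def d_def)
    then show ?thesis by (simp add: fps_shift_times_fps_X_power)
  qed simp
  also have "\<dots> = fps_shift d u * (inverse e * e) * fps_X ^ d"
    using e(2) by (simp add: inverse_mult_eq_1)
  also have "\<dots> = (g - h) * T"
    by (simp add: e(1) T_def mult_ac)
  finally have u: "u = (g - h) * T" .
  have rad_gh: "fps_conv_radius (g - h) > 0"
    using g h less_le_trans[OF _ fps_conv_radius_diff[of g h]] by (auto simp: vanishing_convergent_def)
  then have "fps_conv_radius (inverse e) > 0"
    using e(2) by (intro fps_conv_radius_inverse_pos) (simp_all add: e_def)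
  then have "fps_conv_radius T > 0"
    unfolding T_def u_def using fps_conv_radius_restrict_to_graph[OF g, of F]
    by (intro less_le_trans[OF _ fps_conv_radius_mult]) simp
  then have u': "series_in_y u = (graph_equation h - graph_equation g) * series_in_y T"
    using rad_gh by (simp add: u series_in_y_mult series_in_y_diff_graph_equations[OF g h])
  obtain Q where "F = series_in_y u + graph_equation g * Q"
    unfolding u_def using division_by_graph_equation[OF g] by blast
  moreover obtain U' V' where UV: "1 = U * U'" "1 = V * V'"
    using U V by blast
  ultimately have "F = (Q - series_in_y T) * graph_equation g * (U * U') + series_in_y T * graph_equation h * (V * V')"
    unfolding UV[symmetric] u' by (simp add: algebra_simps)
  then have "F = ((Q - series_in_y T) * U') * (graph_equation g * U) + (series_in_y T * V') * (graph_equation h * V)"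
    by (simp only: mult_ac)
  then show "F \<in> genideal conv_ring {graph_equation g * U, graph_equation h * V}"
    unfolding genideal_pair by blast
qed

lemma const_conv_fps2_eq: "const_conv_fps2 c = series_in_y (fps_const c)"
  by (simp add: const_conv_fps2_def series_in_y_def)

text \<open>
  The classes of the series whose restriction to the first graph has order at least \<open>d - k\<close> form a
  subspace \<open>E\<^sub>k\<close> of the local algebra. One has \<open>E\<^sub>0 = 0\<close>, and \<open>E\<^sub>k\<^sub>+\<^sub>1\<close> is spanned by
  \<open>E\<^sub>k\<close> and the class of \<open>y\<^sup>d\<^sup>-\<^sup>k\<^sup>-\<^sup>1\<close>, so that \<open>E\<^sub>d\<close>, the whole algebra, has dimension \<open>d\<close>.
\<close>

theorem local_algebra_dim_graphs:
  assumes g: "vanishing_convergent g" and h: "vanishing_convergent h" and "g \<noteq> h"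
    and U: "U dvd 1" and V: "V dvd 1"
  shows "local_algebra_dim (graph_equation g * U) (graph_equation h * V) = enat (subdegree (g - h))"
proof -
  define d where "d = subdegree (g - h)"
  define I where "I = genideal conv_ring {graph_equation g * U, graph_equation h * V}"
  define R where "R = conv_ring Quot I"
  define \<pi> where "\<pi> = (\<lambda>F. I +>\<^bsub>conv_ring\<^esub> F)"
  define K where "K = range (\<lambda>c. \<pi> (const_conv_fps2 c))"
  note simps = ring_of_type_algebra_simps[where 'a = conv_fps2]
  interpret C: cring conv_ring
    by (rule cring_from_type_algebra)
  interpret I: ideal I conv_ring
    unfolding I_def by (rule C.genideal_ideal) (simp add: simps)
  interpret R: cring R
    unfolding R_def by (rule I.quotient_is_cring) (rule C.is_cring)
  have I: "F \<in> I \<longleftrightarrow> (\<forall>j<d. restrict_to_graph g F $ j = 0)" for F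
    unfolding I_def d_def ideal_of_two_graphs[OF assms] by simp
  have hom: "\<pi> \<in> ring_hom conv_ring R"
    unfolding \<pi>_def R_def by (rule I.rcos_ring_hom)
  have hom_add: "\<pi> (F + G) = \<pi> F \<oplus>\<^bsub>R\<^esub> \<pi> G" and hom_mult: "\<pi> (F * G) = \<pi> F \<otimes>\<^bsub>R\<^esub> \<pi> G" for F G
    using ring_hom_add[OF hom, of F G] ring_hom_mult[OF hom, of F G] by (simp_all add: simps)
  have \<pi>_eq: "\<pi> F = \<pi> G \<longleftrightarrow> F - G \<in> I" for F G
    unfolding \<pi>_def using C.quotient_eq_iff_same_a_r_cos[OF I.is_ideal, of F G] by (simp add: simps)
  have carrier_R: "carrier R = range \<pi>"
    by (auto simp: R_def FactRing_def A_RCOSETS_def' \<pi>_def simps)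
  have zero_R: "\<zero>\<^bsub>R\<^esub> = \<pi> 0"
    using ring_hom_zero[OF hom C.ring_axioms R.ring_axioms] by (simp add: simps)
  have restrict_diff: "restrict_to_graph g (F - G) = restrict_to_graph g F - restrict_to_graph g G" for F G
    using restrict_to_graph_add[OF g, of "F - G" G] by simp
  have restrict_0: "restrict_to_graph g 0 = 0"
    using restrict_diff[of 0 0] by simp
  have "d > 0"
    using g h \<open>g \<noteq> h\<close> by (auto simp: d_def vanishing_convergent_def subdegree_eq_0_iff intro: gr0I)
  have "subfield K R"
  proof -
    let ?C = "ring_of_type_algebra :: complex ring"
    interpret Complex: field ?C
      by (rule field_from_type_algebra)
    have "ring_hom_ring ?C R (\<lambda>c. \<pi> (const_conv_fps2 c))"
    proof (rule ring_hom_ringI)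
      show "Ring.ring ?C" "Ring.ring R"
        by (rule Complex.ring_axioms, rule R.ring_axioms)
      fix x y :: complex
      have "const_conv_fps2 (x * y) = const_conv_fps2 x * const_conv_fps2 y"
        by transfer simp
      then show "\<pi> (const_conv_fps2 (x \<otimes>\<^bsub>?C\<^esub> y)) = \<pi> (const_conv_fps2 x) \<otimes>\<^bsub>R\<^esub> \<pi> (const_conv_fps2 y)"
        by (simp add: ring_of_type_algebra_simps hom_mult)
      have "const_conv_fps2 (x + y) = const_conv_fps2 x + const_conv_fps2 y"
        by transfer simp
      then show "\<pi> (const_conv_fps2 (x \<oplus>\<^bsub>?C\<^esub> y)) = \<pi> (const_conv_fps2 x) \<oplus>\<^bsub>R\<^esub> \<pi> (const_conv_fps2 y)"
        by (simp add: ring_of_type_algebra_simps hom_add)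
      have "const_conv_fps2 1 = 1"
        by transfer simp
      then show "\<pi> (const_conv_fps2 \<one>\<^bsub>?C\<^esub>) = \<one>\<^bsub>R\<^esub>"
        using ring_hom_one[OF hom] by (simp add: ring_of_type_algebra_simps)
    qed (auto simp: carrier_R)
    moreover have "\<one>\<^bsub>R\<^esub> \<noteq> \<zero>\<^bsub>R\<^esub>"
    proof
      assume "\<one>\<^bsub>R\<^esub> = \<zero>\<^bsub>R\<^esub>"
      then have "\<pi> 1 = \<pi> 0"
        using ring_hom_one[OF hom] zero_R by (simp add: simps)
      then have "restrict_to_graph g 1 $ 0 = 0"
        using \<open>d > 0\<close> by (auto simp: \<pi>_eq I)
      then show False using g by simp
    qed
    ultimately show ?thesis
      using ring_hom_ring.img_is_subfield(2)[OF _ Complex.carrier_is_subfield]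
      by (simp add: K_def ring_of_type_algebra_simps)
  qed
  define E where "E k = \<pi> ` {F. \<forall>j<d - k. restrict_to_graph g F $ j = 0}" for k
  have "R.dimension k K (E k)" if "k \<le> d" for k
    using that
  proof (induction k)
    case 0
    have "E 0 = \<pi> ` I"
      unfolding E_def by (rule arg_cong[of _ _ "image \<pi>"]) (auto simp: I)
    also have "\<dots> = (\<lambda>_. \<pi> 0) ` I"
      by (rule image_cong) (simp_all add: \<pi>_eq)
    also have "\<dots> = {\<pi> 0}"
      using I.zero_closed by (simp add: image_constant simps)
    finally show ?case
      by (simp add: zero_R[symmetric] R.zero_dim)
  next
    case (Suc k)
    define m where "m = d - Suc k"
    have m: "m < d - k" "m < d" "j < d - k \<longleftrightarrow> j < m \<or> j = m" for j
      using Suc.prems by (auto simp: m_def)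
    define v where "v = series_in_y (fps_X ^ m)"
    have restrict_v: "restrict_to_graph g (const_conv_fps2 c * v) = fps_const c * fps_X ^ m" for c
      unfolding const_conv_fps2_eq v_def using g
      by (simp add: restrict_to_graph_mult restrict_to_graph_series_in_y)
    have restrict_v1: "restrict_to_graph g v = fps_X ^ m"
      unfolding v_def using g by (simp add: restrict_to_graph_series_in_y)
    have "R.line_extension K (\<pi> v) (E k) = E (Suc k)"
    proof (intro equalityI subsetI)
      fix x assume "x \<in> R.line_extension K (\<pi> v) (E k)"
      then obtain c F where F: "\<forall>j<d - k. restrict_to_graph g F $ j = 0"
        and "x = \<pi> (const_conv_fps2 c) \<otimes>\<^bsub>R\<^esub> \<pi> v \<oplus>\<^bsub>R\<^esub> \<pi> F"
        unfolding R.line_extension_mem_iff K_def E_def by blast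
      then have "x = \<pi> (const_conv_fps2 c * v + F)"
        by (simp add: hom_add hom_mult)
      moreover have "\<forall>j<d - Suc k. restrict_to_graph g (const_conv_fps2 c * v + F) $ j = 0"
        using F m by (simp add: restrict_to_graph_add[OF g] restrict_v flip: m_def)
      ultimately show "x \<in> E (Suc k)"
        unfolding E_def by blast
    next
      fix x assume "x \<in> E (Suc k)"
      then obtain G where x: "x = \<pi> G" and G: "\<forall>j<m. restrict_to_graph g G $ j = 0"
        by (auto simp: E_def m_def)
      (* Subtracting c y^m removes the lowest coefficient. *)
      define c where "c = restrict_to_graph g G $ m"
      define F where "F = G - const_conv_fps2 c * v"
      have "\<forall>j<d - k. restrict_to_graph g F $ j = 0"
        unfolding F_def restrict_diff restrict_v m(3) using G by (auto simp: c_def)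
      then have "\<pi> F \<in> E k" by (auto simp: E_def)
      moreover have "x = \<pi> (const_conv_fps2 c) \<otimes>\<^bsub>R\<^esub> \<pi> v \<oplus>\<^bsub>R\<^esub> \<pi> F"
        by (simp add: x F_def flip: hom_add hom_mult)
      ultimately show "x \<in> R.line_extension K (\<pi> v) (E k)"
        unfolding R.line_extension_mem_iff K_def by blast
    qed
    moreover have "\<pi> v \<notin> E k"
    proof
      assume "\<pi> v \<in> E k"
      then obtain F where F: "\<forall>j<d - k. restrict_to_graph g F $ j = 0" and "\<pi> v = \<pi> F"
        by (auto simp: E_def)
      then have "restrict_to_graph g v $ m = restrict_to_graph g F $ m"
        using m(2) by (simp add: \<pi>_eq I restrict_diff)
      then show False
        using F m(1) by (simp add: restrict_v1)
    qed
    moreover have "\<pi> v \<in> carrier R"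
      by (simp add: carrier_R)
    ultimately show ?case
      using R.Suc_dim[of "\<pi> v" "E k" k K] Suc by simp
  qed
  then have "R.dimension d K (E d)"
    by simp
  moreover have "E d = carrier R"
    by (simp add: E_def carrier_R)
  ultimately have dim: "R.dimension d K (carrier R)"
    by simp
  have "(THE n. R.dimension n K (carrier R)) = d"
    using dim R.dimension_is_inj[OF \<open>subfield K R\<close>] by (intro the_equality) blast+
  then show ?thesis
    using dim unfolding local_algebra_dim_def local_algebra_def local_algebra_scalars_def Let_def
    by (fold I_def, fold R_def \<pi>_def, fold K_def d_def) auto
qed

theorem intersection_multiplicity_graph_germs:
  assumes g: "vanishing_convergent g" and h: "vanishing_convergent h" and "g \<noteq> h"
  shows "intersection_multiplicity (graph_germ g) (graph_germ h) = enat (subdegree (g - h))"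
proof -
  have "\<exists>U. U dvd 1 \<and> (SOME F. reduced_local_equation F (graph_germ k)) = graph_equation k * U"
    if k: "vanishing_convergent k" for k
    using reduced_local_equation_graph_germ_unique[OF k someI[of "\<lambda>F. reduced_local_equation F (graph_germ k)",
        OF reduced_local_equation_graph_equation[OF k]]] by metis
  then show ?thesis
    unfolding intersection_multiplicity_def using local_algebra_dim_graphs[OF assms] g h by metis
qed

section \<open>A family of graphs indexed by sign sequences\<close>

abbreviation branch_sign :: "(nat \<Rightarrow> bool) \<Rightarrow> complex" where
  "branch_sign s \<equiv> (if s 0 then 1 else -1)"

text \<open>
  With \<open>g\<^sub>s = y\<^sup>2 h\<^sub>s\<close>, the equation \<open>g\<^sub>s(y)\<^sup>2 = y\<^sup>4 + g\<^sub>\<sigma>\<^sub>s(y\<^sup>4)\<close> becomes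
  \<open>h\<^sub>s(y)\<^sup>2 = 1 + y\<^sup>4 h\<^sub>\<sigma>\<^sub>s(y\<^sup>4)\<close>. Together with the choice \<open>h\<^sub>s(0) = \<plusminus>1\<close> given by
  the first sign, it determines the coefficients of all \<open>h\<^sub>s\<close> by simultaneous recursion; the factor
  \<open>\<plusminus>1/2\<close> is the inverse of \<open>2 h\<^sub>s(0)\<close>. The sign sequences are encoded as predicates on the
  natural numbers, true meaning plus.
\<close>

fun branch_coeff :: "(nat \<Rightarrow> bool) \<Rightarrow> nat \<Rightarrow> complex" where
  "branch_coeff s n =
     (if n = 0 then branch_sign s
      else branch_sign s / 2 *
        ((if 4 dvd n then branch_coeff (\<lambda>i. s (Suc i)) (n div 4 - 1) else 0)
         - (\<Sum>i = 1..<n. branch_coeff s i * branch_coeff s (n - i))))"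

declare branch_coeff.simps [simp del]

definition branch_unit :: "(nat \<Rightarrow> bool) \<Rightarrow> complex fps" where
  "branch_unit s = Abs_fps (branch_coeff s)"

definition branch :: "(nat \<Rightarrow> bool) \<Rightarrow> complex fps" where
  "branch s = fps_X ^ 2 * branch_unit s"

lemma branch_coeff_0 [simp]: "branch_coeff s 0 = branch_sign s"
  by (simp add: branch_coeff.simps)

lemma branch_unit_square:
  "branch_unit s * branch_unit s =
     1 + Abs_fps (\<lambda>n. if n > 0 \<and> 4 dvd n then branch_coeff (\<lambda>i. s (Suc i)) (n div 4 - 1) else 0)"
proof (rule fps_ext)
  fix n
  let ?S = "\<Sum>i = 1..<n. branch_coeff s i * branch_coeff s (n - i)"
  show "(branch_unit s * branch_unit s) $ n = (1 +
     Abs_fps (\<lambda>n. if n > 0 \<and> 4 dvd n then branch_coeff (\<lambda>i. s (Suc i)) (n div 4 - 1) else 0)) $ n"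
  proof (cases "n = 0")
    case False
    then have set: "{0..n} = insert 0 (insert n {1..<n})"
      by auto
    have "(branch_unit s * branch_unit s) $ n = 2 * branch_sign s * branch_coeff s n + ?S"
      unfolding fps_mult_nth branch_unit_def fps_nth_Abs_fps set using False by simp
    also have "2 * branch_sign s * branch_coeff s n =
        (if 4 dvd n then branch_coeff (\<lambda>i. s (Suc i)) (n div 4 - 1) else 0) - ?S"
      using False by (subst branch_coeff.simps) auto
    finally show ?thesis using False by simp
  qed (simp add: branch_unit_def)
qed

text \<open>
  The pairs \<open>(i, n - i)\<close> occurring on the left are distinct and lie in the square \<open>{1..N}\<^sup>2\<close>.
\<close>

lemma sum_convolution_le:
  fixes b :: "nat \<Rightarrow> real"
  assumes "\<And>i. b i \<ge> 0"
  shows "(\<Sum>n = 1..Suc N. \<Sum>i = 1..<n. b i * b (n - i)) \<le> (\<Sum>i = 1..N. b i) * (\<Sum>i = 1..N. b i)"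
proof -
  have "(\<Sum>n = 1..Suc N. \<Sum>i = 1..<n. b i * b (n - i))
      = (\<Sum>(n, i)\<in>Sigma {1..Suc N} (\<lambda>n. {1..<n}). b i * b (n - i))"
    by (rule sum.Sigma) auto
  also have "\<dots> \<le> (\<Sum>(i, j)\<in>{1..N} \<times> {1..N}. b i * b j)"
  proof (rule sum_le_included[where i = "\<lambda>(i, j). (i + j, i)"])
    show "\<forall>x\<in>Sigma {1..Suc N} (\<lambda>n. {1..<n}). \<exists>y\<in>{1..N} \<times> {1..N}.
        (case y of (i, j) \<Rightarrow> (i + j, i)) = x \<and>
        (case x of (n, i) \<Rightarrow> b i * b (n - i)) \<le> (case y of (i, j) \<Rightarrow> b i * b j)"
    proof
      fix x assume "x \<in> Sigma {1..Suc N} (\<lambda>n. {1..<n})"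
      then obtain n i where "x = (n, i)" "1 \<le> i" "i < n" "n \<le> Suc N"
        by auto
      then show "\<exists>y\<in>{1..N} \<times> {1..N}. (case y of (i, j) \<Rightarrow> (i + j, i)) = x \<and>
        (case x of (n, i) \<Rightarrow> b i * b (n - i)) \<le> (case y of (i, j) \<Rightarrow> b i * b j)"
        by (intro bexI[of _ "(i, n - i)"]) auto
    qed
  qed (use assms in auto)
  also have "\<dots> = (\<Sum>i = 1..N. b i) * (\<Sum>i = 1..N. b i)"
    by (simp add: sum_product sum.cartesian_product)
  finally show ?thesis .
qed

text \<open>
  A majorant argument. Write \<open>B\<^sub>N\<close> for the left-hand side. The recursion bounds \<open>B\<^sub>N\<^sub>+\<^sub>1\<close> by half
  of \<open>(1 + B\<^sub>N) / 16 + B\<^sub>N\<^sup>2\<close>, where \<open>B\<^sub>N\<close> is taken once for the shifted sequence and once for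
  \<open>s\<close> itself; the bound \<open>1/2\<close> is preserved because \<open>3/32 + 1/4 \<le> 1\<close>.
\<close>

lemma branch_coeff_sum_le: "(\<Sum>n = 1..N. norm (branch_coeff s n) * (1 / 2) ^ n) \<le> 1 / 2"
proof (induction N arbitrary: s)
  case (Suc N)
  define b where "b n = norm (branch_coeff s n) * (1 / 2) ^ n" for n
  define k where "k n = norm (branch_coeff (\<lambda>i. s (Suc i)) n) * (1 / 2) ^ n" for n
  define a where "a n = (if 4 dvd n then norm (branch_coeff (\<lambda>i. s (Suc i)) (n div 4 - 1)) * (1 / 2) ^ n else 0)" for n
  have b_le: "b n \<le> (a n + (\<Sum>i = 1..<n. b i * b (n - i))) / 2" if "n \<ge> 1" for n
  proof -
    define A where "A = (if 4 dvd n then branch_coeff (\<lambda>i. s (Suc i)) (n div 4 - 1) else 0)"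
    define S where "S = (\<Sum>i = 1..<n. branch_coeff s i * branch_coeff s (n - i))"
    have "branch_coeff s n = branch_sign s / 2 * (A - S)"
      unfolding A_def S_def using that by (subst branch_coeff.simps) auto
    then have "norm (branch_coeff s n) = norm (branch_sign s / 2) * norm (A - S)"
      by (simp only: norm_mult)
    also have "norm (branch_sign s / 2) = 1 / 2"
      by (simp add: norm_divide)
    also have "1 / 2 * norm (A - S) = norm (A - S) / 2"
      by simp
    also have "\<dots> \<le> (norm A + norm S) / 2"
      by (intro divide_right_mono norm_triangle_ineq4) auto
    finally have b: "b n \<le> (norm A * (1 / 2) ^ n + norm S * (1 / 2) ^ n) / 2"
      unfolding b_def by (simp add: field_simps)
    have A: "norm A * (1 / 2) ^ n = a n"
      by (simp add: A_def a_def)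
    have S: "norm S * (1 / 2) ^ n \<le> (\<Sum>i = 1..<n. b i * b (n - i))"
    proof -
      have "norm S * (1 / 2) ^ n \<le> (\<Sum>i = 1..<n. norm (branch_coeff s i * branch_coeff s (n - i))) * (1 / 2) ^ n"
        unfolding S_def by (intro mult_right_mono norm_sum) auto
      also have "\<dots> = (\<Sum>i = 1..<n. b i * b (n - i))"
        unfolding sum_distrib_right
      proof (rule sum.cong)
        fix i assume "i \<in> {1..<n}"
        then have "(1 / 2 :: real) ^ n = (1 / 2) ^ i * (1 / 2) ^ (n - i)"
          by (simp flip: power_add)
        then show "norm (branch_coeff s i * branch_coeff s (n - i)) * (1 / 2) ^ n = b i * b (n - i)"
          by (simp add: b_def norm_mult)
      qed simp
      finally show ?thesis .
    qed
    show ?thesis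
      using order.trans[OF b[unfolded A] divide_right_mono[OF add_left_mono[OF S]]] by simp
  qed
  have "(\<Sum>n = 1..Suc N. a n) = (\<Sum>n \<in> {n \<in> {1..Suc N}. 4 dvd n}. a n)"
    by (intro sum.mono_neutral_right) (auto simp: a_def)
  also have "\<dots> \<le> (\<Sum>m = 0..N. k m / 16)"
  proof (rule sum_le_included[where i = "\<lambda>m. 4 * Suc m"])
    show "\<forall>n\<in>{n \<in> {1..Suc N}. 4 dvd n}. \<exists>m\<in>{0..N}. 4 * Suc m = n \<and> a n \<le> k m / 16"
    proof
      fix n assume "n \<in> {n \<in> {1..Suc N}. 4 dvd n}"
      then obtain q where "n = 4 * q" "n \<ge> 1" "n \<le> Suc N"
        by (auto elim: dvdE)
      then obtain m where m: "n = 4 * Suc m" "m \<le> N"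
        by (cases q) auto
      have "4 * Suc m = 3 * m + m + 4"
        by simp
      then have "(1 / 2 :: real) ^ (4 * Suc m) = (1 / 2) ^ (3 * m) * ((1 / 2) ^ m / 16)"
        by (simp only: power_add) (simp add: power_one_over)
      also have "\<dots> \<le> 1 * ((1 / 2) ^ m / 16)"
        by (intro mult_right_mono power_le_one) auto
      finally have "norm (branch_coeff (\<lambda>i. s (Suc i)) m) * (1 / 2) ^ (4 * Suc m)
          \<le> norm (branch_coeff (\<lambda>i. s (Suc i)) m) * ((1 / 2) ^ m / 16)"
        by (intro mult_left_mono) auto
      then have "a n \<le> k m / 16"
        unfolding a_def k_def m(1) by simp
      then show "\<exists>m\<in>{0..N}. 4 * Suc m = n \<and> a n \<le> k m / 16"
        using m by (intro bexI[of _ m]) auto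
    qed
  qed (auto simp: k_def)
  also have "\<dots> = (k 0 + (\<Sum>m = 1..N. k m)) / 16"
    by (simp add: sum.atLeast_Suc_atMost flip: sum_divide_distrib)
  also have "\<dots> \<le> (1 + 1 / 2) / 16"
    using Suc.IH[of "\<lambda>i. s (Suc i)"] by (simp add: k_def)
  finally have a: "(\<Sum>n = 1..Suc N. a n) \<le> 3 / 32"
    by simp
  have "(\<Sum>n = 1..Suc N. \<Sum>i = 1..<n. b i * b (n - i)) \<le> (\<Sum>i = 1..N. b i) * (\<Sum>i = 1..N. b i)"
    by (rule sum_convolution_le) (simp add: b_def)
  also have "\<dots> \<le> 1 / 2 * (1 / 2)"
    using Suc.IH[of s] by (intro mult_mono) (auto simp: b_def intro: sum_nonneg)
  finally have c: "(\<Sum>n = 1..Suc N. \<Sum>i = 1..<n. b i * b (n - i)) \<le> 1 / 4"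
    by simp
  have "(\<Sum>n = 1..Suc N. b n) \<le> (\<Sum>n = 1..Suc N. (a n + (\<Sum>i = 1..<n. b i * b (n - i))) / 2)"
    by (intro sum_mono b_le) auto
  also have "\<dots> = ((\<Sum>n = 1..Suc N. a n) + (\<Sum>n = 1..Suc N. \<Sum>i = 1..<n. b i * b (n - i))) / 2"
    by (simp only: sum_divide_distrib[symmetric] sum.distrib)
  also have "\<dots> \<le> 1 / 2"
    by (rule order.trans[OF divide_right_mono[OF add_mono[OF a c]]]) simp_all
  finally show ?case by (simp add: b_def)
qed simp

lemma norm_branch_coeff_le: "norm (branch_coeff s n) \<le> 2 ^ n"
proof (cases "n = 0")
  case False
  have "norm (branch_coeff s n) * (1 / 2) ^ n \<le> (\<Sum>m = 1..n. norm (branch_coeff s m) * (1 / 2) ^ m)"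
    using False by (intro member_le_sum) auto
  also have "\<dots> \<le> 1"
    using branch_coeff_sum_le[of s n] by simp
  finally show ?thesis by (simp add: power_divide field_simps)
qed simp

lemma fps_conv_radius_branch_unit: "fps_conv_radius (branch_unit s) > 0"
  unfolding fps2_convergent_fps_const_iff[symmetric]
proof (rule fps2_convergentI[of "1 / 2" _ 1])
  fix i j
  show "norm (fps_const (branch_unit s) $ i $ j) * (1 / 2) ^ (i + j) \<le> 1"
    using norm_branch_coeff_le[of s j] by (cases i) (auto simp: branch_unit_def power_divide field_simps)
qed simp

lemma vanishing_convergent_branch: "vanishing_convergent (branch s)"
proof -
  have "fps_conv_radius (branch s) > 0"
    unfolding branch_def using fps_conv_radius_branch_unit[of s]
    by (intro less_le_trans[OF _ fps_conv_radius_mult]) simp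
  then show ?thesis
    by (simp add: vanishing_convergent_def branch_def)
qed

lemma eval_branch_unit_square:
  assumes y: "ereal (norm y) < fps_conv_radius (branch_unit s)"
    and y4: "ereal (norm (y ^ 4)) < fps_conv_radius (branch_unit (\<lambda>i. s (Suc i)))"
  shows "eval_fps (branch_unit s) y ^ 2 = 1 + y ^ 4 * eval_fps (branch_unit (\<lambda>i. s (Suc i))) (y ^ 4)"
proof -
  let ?k = "branch_coeff (\<lambda>i. s (Suc i))"
  define f where "f n = (if n > 0 \<and> 4 dvd n then ?k (n div 4 - 1) else 0)" for n
  have "(\<lambda>m. branch_unit (\<lambda>i. s (Suc i)) $ m * (y ^ 4) ^ m) sums eval_fps (branch_unit (\<lambda>i. s (Suc i))) (y ^ 4)"
    by (rule sums_eval_fps[OF y4])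
  from sums_mult[OF this, of "y ^ 4"]
  moreover have "f (4 * Suc m) * y ^ (4 * Suc m) = y ^ 4 * (branch_unit (\<lambda>i. s (Suc i)) $ m * (y ^ 4) ^ m)" for m
  proof -
    have "y ^ (4 * Suc m) = y ^ 4 * (y ^ 4) ^ m"
      by (simp only: power_mult power_Suc)
    then show ?thesis by (simp add: f_def branch_unit_def)
  qed
  ultimately have "(\<lambda>m. f (4 * Suc m) * y ^ (4 * Suc m)) sums (y ^ 4 * eval_fps (branch_unit (\<lambda>i. s (Suc i))) (y ^ 4))"
    by simp
  also have "?this \<longleftrightarrow> (\<lambda>n. f n * y ^ n) sums (y ^ 4 * eval_fps (branch_unit (\<lambda>i. s (Suc i))) (y ^ 4))"
  proof (rule sums_mono_reindex[where f = "\<lambda>n. f n * y ^ n"])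
    show "strict_mono (\<lambda>m. 4 * Suc m)"
      by (rule strict_monoI) simp
    fix n assume n: "n \<notin> range (\<lambda>m. 4 * Suc m)"
    have "\<not> (n > 0 \<and> 4 dvd n)"
    proof
      assume "n > 0 \<and> 4 dvd n"
      then have "n = 4 * Suc (n div 4 - 1)"
        by (auto elim!: dvdE)
      with n show False by blast
    qed
    then show "f n * y ^ n = 0" by (auto simp: f_def)
  qed
  finally have "(\<lambda>n. 1 $ n * y ^ n + f n * y ^ n) sums
      (1 + y ^ 4 * eval_fps (branch_unit (\<lambda>i. s (Suc i))) (y ^ 4))"
    using sums_eval_fps[of y "1 :: complex fps"] by (intro sums_add) auto
  moreover have "(branch_unit s * branch_unit s) $ n * y ^ n = 1 $ n * y ^ n + f n * y ^ n" for n
    unfolding branch_unit_square by (simp add: f_def algebra_simps)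
  ultimately have "eval_fps (branch_unit s * branch_unit s) y =
      1 + y ^ 4 * eval_fps (branch_unit (\<lambda>i. s (Suc i))) (y ^ 4)"
    by (simp add: eval_fps_def sums_iff)
  then show ?thesis
    by (simp add: eval_fps_mult[OF y y] power2_eq_square)
qed

lemma eval_branch:
  assumes "ereal (norm y) < fps_conv_radius (branch_unit s)"
  shows "eval_fps (branch s) y = y ^ 2 * eval_fps (branch_unit s) y"
  unfolding branch_def using assms by (subst eval_fps_mult) auto

lemma eventually_in_conv_radius:
  fixes F :: "complex fps"
  assumes "fps_conv_radius F > 0"
  shows "\<forall>\<^sub>F y in nhds 0. ereal (norm y) < fps_conv_radius F"
proof -
  have "\<forall>\<^sub>F y in nhds 0. y \<in> eball 0 (fps_conv_radius F)"
    using assms by (intro eventually_nhds_in_open) (auto simp: in_eball_iff zero_ereal_def)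
  then show ?thesis by eventually_elim (simp add: in_eball_iff)
qed

lemma filterlim_power_nhds_0: "filterlim (\<lambda>y :: complex. y ^ k) (nhds 0) (nhds 0)" if "k > 0"
proof -
  have "((\<lambda>y :: complex. y ^ k) \<longlongrightarrow> 0 ^ k) (nhds 0)"
    by (intro tendsto_power filterlim_ident)
  then show ?thesis using that by (simp only: zero_power)
qed

text \<open>
  The first coordinate of the image is \<open>g\<^sub>s(y)\<^sup>2 - y\<^sup>4 = g\<^sub>\<sigma>\<^sub>s(y\<^sup>4)\<close>.
\<close>

lemma f_map_maps_branch:
  "\<forall>\<^sub>F y in nhds 0. f_map (eval_fps (branch s) y, y) =
     (eval_fps (branch (\<lambda>i. s (Suc i))) (y ^ 4), y ^ 4)"
proof -
  have "\<forall>\<^sub>F y in nhds (0 :: complex). ereal (norm (y ^ 4)) < fps_conv_radius (branch_unit (\<lambda>i. s (Suc i)))"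
    by (rule eventually_compose_filterlim[OF eventually_in_conv_radius[OF fps_conv_radius_branch_unit]])
      (rule filterlim_power_nhds_0, simp)
  with eventually_in_conv_radius[OF fps_conv_radius_branch_unit[of s]] show ?thesis
  proof eventually_elim
    case (elim y)
    have "eval_fps (branch s) y ^ 2 - y ^ 4 = y ^ 4 * (eval_fps (branch_unit s) y ^ 2 - 1)"
      by (simp add: eval_branch[OF elim(1)] algebra_simps power_mult_distrib flip: power_mult)
    also have "\<dots> = eval_fps (branch (\<lambda>i. s (Suc i))) (y ^ 4)"
      by (simp only: eval_branch[OF elim(2)] eval_branch_unit_square[OF elim])
        (simp add: power2_eq_square mult.assoc)
    finally show ?case by (simp add: f_map_def)
  qed
qed

lemma f_map_funpow_maps_branch:
  "\<forall>\<^sub>F y in nhds 0. (f_map ^^ n) (eval_fps (branch s) y, y) =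
     (eval_fps (branch (\<lambda>i. s (i + n))) (y ^ (4 ^ n)), y ^ (4 ^ n))"
proof (induction n)
  case (Suc n)
  have "\<forall>\<^sub>F y in nhds 0. f_map (eval_fps (branch (\<lambda>i. s (i + n))) (y ^ (4 ^ n)), y ^ (4 ^ n)) =
     (eval_fps (branch (\<lambda>i. s (Suc i + n))) ((y ^ (4 ^ n)) ^ 4), (y ^ (4 ^ n)) ^ 4)"
    by (rule eventually_compose_filterlim[OF f_map_maps_branch filterlim_power_nhds_0]) simp
  with Suc.IH show ?case
    by eventually_elim (simp add: mult.commute flip: power_mult)
qed simp

text \<open>
  One step of the recursion that passes to the shifted sequence drops one sign but divides the
  index by four, so the \<open>n\<close>-th coefficient depends on the first \<open>n + 1\<close> signs at most.
\<close>

lemma branch_coeff_cong: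
  assumes "\<And>i. i < L \<Longrightarrow> s i = t i" "n < L"
  shows "branch_coeff s n = branch_coeff t n"
  using assms
proof (induction n arbitrary: s t L rule: less_induct)
  case (less n)
  show ?case
  proof (cases "n = 0")
    case True
    then show ?thesis using less.prems(1)[of 0] less.prems(2) by simp
  next
    case False
    have "branch_coeff (\<lambda>i. s (Suc i)) (n div 4 - 1) = branch_coeff (\<lambda>i. t (Suc i)) (n div 4 - 1)"
    proof (rule less.IH[where L = "L - 1"])
      show "n div 4 - 1 < n" "n div 4 - 1 < L - 1"
        using False less.prems(2) by linarith+
      show "s (Suc i) = t (Suc i)" if "i < L - 1" for i
        using less.prems(1) that by simp
    qed
    moreover have "(\<Sum>i = 1..<n. branch_coeff s i * branch_coeff s (n - i))
        = (\<Sum>i = 1..<n. branch_coeff t i * branch_coeff t (n - i))"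
    proof (intro sum.cong refl arg_cong2[of _ _ _ _ "(*)"])
      fix i assume "i \<in> {1..<n}"
      then have "i < n" "n - i < n" "i < L" "n - i < L"
        using less.prems(2) by auto
      then show "branch_coeff s i = branch_coeff t i" "branch_coeff s (n - i) = branch_coeff t (n - i)"
        using less.IH less.prems(1) by blast+
    qed
    moreover have "branch_sign s = branch_sign t"
      using less.prems by simp
    ultimately show ?thesis
      by (subst (1 2) branch_coeff.simps) simp
  qed
qed

text \<open>
  The constant coefficient of \<open>h\<^sub>s\<close> is the first sign, and \<open>h\<^sub>s\<^sup>2\<close> determines \<open>h\<^sub>\<sigma>\<^sub>s\<close>.
\<close>

lemma inj_branch: "branch s = branch t \<Longrightarrow> s = t"
proof -
  assume "branch s = branch t"
  then have "branch_unit s = branch_unit t"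
    by (simp add: branch_def)
  then have "branch_coeff s = branch_coeff t"
    unfolding branch_unit_def by (metis fps_nth_Abs_fps ext)
  moreover have "branch_coeff s = branch_coeff t \<Longrightarrow> s i = t i" for i
  proof (induction i arbitrary: s t)
    case 0
    then have "branch_sign s = branch_sign t"
      using branch_coeff_0 by metis
    then show ?case by (auto split: if_splits)
  next
    case (Suc i)
    have "branch_coeff (\<lambda>i. s (Suc i)) m = branch_coeff (\<lambda>i. t (Suc i)) m" for m
    proof -
      have "branch_unit s = branch_unit t"
        using Suc.prems by (simp add: branch_unit_def)
      then have "(branch_unit s * branch_unit s) $ (4 * Suc m) = (branch_unit t * branch_unit t) $ (4 * Suc m)"
        by simp
      then show ?thesis
        unfolding branch_unit_square by simp
    qed
    then show ?case
      using Suc.IH[of "\<lambda>i. s (Suc i)" "\<lambda>i. t (Suc i)"] by blast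
  qed
  ultimately show ?thesis by blast
qed

lemma subdegree_branch_diff_ge:
  assumes "\<And>i. i < L \<Longrightarrow> s i = t i" "s \<noteq> t"
  shows "L \<le> subdegree (branch s - branch t)"
proof (rule subdegree_geI)
  show "branch s - branch t \<noteq> 0"
    using assms(2) inj_branch by auto
  fix n assume "n < L"
  then have "branch_unit s $ (n - 2) = branch_unit t $ (n - 2)"
    unfolding branch_unit_def using branch_coeff_cong[of L s t "n - 2"] assms(1) by simp
  then show "(branch s - branch t) $ n = 0"
    by (simp add: branch_def fps_X_power_mult_nth)
qed

section \<open>Images of graph germs\<close>

lemma germ_surj: "\<exists>A. germ A = D"
proof transfer
  fix D :: "(complex \<times> complex) set"
  show "\<exists>A. \<forall>\<^sub>F z in nhds 0. z \<in> A \<longleftrightarrow> z \<in> D"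
    by (rule exI[of _ D]) simp
qed

text \<open>
  Two candidates for the image germ are compared on the intersection of their neighbourhoods.
\<close>

lemma image_germ_eqI:
  assumes "\<And>A. germ A = D \<Longrightarrow>
    \<exists>U\<^sub>0. open U\<^sub>0 \<and> 0 \<in> U\<^sub>0 \<and> (\<forall>U. open U \<and> 0 \<in> U \<and> U \<subseteq> U\<^sub>0 \<longrightarrow> germ (f ` (A \<inter> U)) = E)"
  shows "image_germ f D = E"
  unfolding image_germ_def
proof (rule the_equality)
  fix E'
  assume E': "\<forall>A. germ A = D \<longrightarrow> (\<exists>U\<^sub>0. open U\<^sub>0 \<and> 0 \<in> U\<^sub>0 \<and>
    (\<forall>U. open U \<and> 0 \<in> U \<and> U \<subseteq> U\<^sub>0 \<longrightarrow> germ (f ` (A \<inter> U)) = E'))"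
  obtain A where A: "germ A = D"
    using germ_surj by blast
  from assms[OF A] obtain U where U: "open U" "0 \<in> U"
    "\<forall>W. open W \<and> 0 \<in> W \<and> W \<subseteq> U \<longrightarrow> germ (f ` (A \<inter> W)) = E"
    by (elim exE conjE) (rule that)
  from E'[rule_format, OF A] obtain U' where U': "open U'" "0 \<in> U'"
    "\<forall>W. open W \<and> 0 \<in> W \<and> W \<subseteq> U' \<longrightarrow> germ (f ` (A \<inter> W)) = E'"
    by (elim exE conjE) (rule that)
  have "open (U \<inter> U')" "0 \<in> U \<inter> U'"
    using U(1,2) U'(1,2) by auto
  then show "E' = E"
    using U(3)[rule_format, of "U \<inter> U'"] U'(3)[rule_format, of "U \<inter> U'"] by simp
qed (intro allI impI assms)

text \<open>
  Surjectivity onto the germ of the second graph comes from \<open>y \<mapsto> y\<^sup>k\<close> being surjective from small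
  discs to small discs.
\<close>

lemma image_germ_graph_germ:
  assumes g: "vanishing_convergent g" and "k > 0"
    and f: "\<forall>\<^sub>F y in nhds 0. f (eval_fps g y, y) = (eval_fps h (y ^ k), y ^ k)"
  shows "image_germ f (graph_germ g) = graph_germ h"
proof (rule image_germ_eqI)
  fix A assume "germ A = graph_germ g"
  then have "\<forall>\<^sub>F z in nhds 0. z \<in> A \<longleftrightarrow> fst z = eval_fps g (snd z)"
    by (simp add: graph_germ_def germ_eq_iff)
  then obtain S where S: "open S" "0 \<in> S" "\<And>z. z \<in> S \<Longrightarrow> z \<in> A \<longleftrightarrow> fst z = eval_fps g (snd z)"
    unfolding eventually_nhds by blast
  obtain T where T: "open T" "0 \<in> T" "\<And>y. y \<in> T \<Longrightarrow> f (eval_fps g y, y) = (eval_fps h (y ^ k), y ^ k)"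
    using f unfolding eventually_nhds by blast
  define U0 where "U0 = S \<inter> snd -` T"
  have "germ (f ` (A \<inter> U)) = graph_germ h" if U: "open U" "0 \<in> U" "U \<subseteq> U0" for U
  proof -
    have "\<forall>\<^sub>F z in nhds 0. z \<in> U"
      using U by (intro eventually_nhds_in_open)
    from eventually_on_graph[OF g this]
    obtain \<delta> where \<delta>: "\<delta> > 0" "\<And>y. dist y 0 < \<delta> \<Longrightarrow> (eval_fps g y, y) \<in> U"
      unfolding eventually_nhds_metric by blast
    show ?thesis
      unfolding graph_germ_def germ_eq_iff
    proof (rule eventually_nhds_0_polydisc)
      show "\<delta> ^ k > 0" using \<delta>(1) by simp
      fix x w :: complex assume w: "norm w < \<delta> ^ k"
      show "(x, w) \<in> f ` (A \<inter> U) \<longleftrightarrow> (x, w) \<in> {z. fst z = eval_fps h (snd z)}"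
      proof
        assume "(x, w) \<in> f ` (A \<inter> U)"
        then obtain a y where ay: "(a, y) \<in> A" "(a, y) \<in> U" "(x, w) = f (a, y)"
          by auto
        then have "(a, y) \<in> S" "y \<in> T"
          using U(3) by (auto simp: U0_def)
        then have "(x, w) = (eval_fps h (y ^ k), y ^ k)"
          using S(3)[of "(a, y)"] T(3)[of y] ay by simp
        then show "(x, w) \<in> {z. fst z = eval_fps h (snd z)}" by simp
      next
        assume x: "(x, w) \<in> {z. fst z = eval_fps h (snd z)}"
        obtain y where y: "w = y ^ k"
          using exists_complex_root[of k w] \<open>k > 0\<close> by blast
        then have "norm y < \<delta>"
          using w \<delta>(1) power_less_imp_less_base[of "norm y" k \<delta>] by (simp add: norm_power)
        then have "(eval_fps g y, y) \<in> U"
          using \<delta>(2) by (simp add: dist_norm)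
        moreover from this have "(eval_fps g y, y) \<in> A" "y \<in> T"
          using U(3) S(3)[of "(eval_fps g y, y)"] by (auto simp: U0_def)
        moreover from this have "f (eval_fps g y, y) = (x, w)"
          using T(3) x y by simp
        ultimately show "(x, w) \<in> f ` (A \<inter> U)"
          by (metis IntI imageI)
      qed
    qed
  qed
  moreover have "open U0" "0 \<in> U0"
    using S T by (auto simp: U0_def intro!: open_Int open_vimage continuous_intros)
  ultimately show "\<exists>U\<^sub>0. open U\<^sub>0 \<and> 0 \<in> U\<^sub>0 \<and>
      (\<forall>U. open U \<and> 0 \<in> U \<and> U \<subseteq> U\<^sub>0 \<longrightarrow> germ (f ` (A \<inter> U)) = graph_germ h)"
    by blast
qed

lemma image_germ_branch:
  "image_germ (f_map ^^ n) (graph_germ (branch s)) = graph_germ (branch (\<lambda>i. s (i + n)))"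
  by (rule image_germ_graph_germ[OF vanishing_convergent_branch _ f_map_funpow_maps_branch]) simp

lemma curve_germ_branch: "curve_germ (graph_germ (branch s))"
  unfolding curve_germ_def using reduced_local_equation_graph_equation[OF vanishing_convergent_branch] by blast

section \<open>A code with prescribed constant blocks\<close>

text \<open>
  The block beginning at position \<open>p\<close> has length \<open>\<lceil>\<nu>(p)\<rceil> + 1 > \<nu>(p)\<close> (with the ceiling cut off
  at zero); one further position holds the separating sign.
\<close>

fun block_start :: "(nat \<Rightarrow> real) \<Rightarrow> nat \<Rightarrow> nat" where
  "block_start \<nu> 0 = 0"
| "block_start \<nu> (Suc j) = block_start \<nu> j + nat \<lceil>\<nu> (block_start \<nu> j)\<rceil> + 2"

text \<open>
  The separating signs sit immediately before the beginnings of the blocks other than the first.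
\<close>

definition recurrent_code :: "(nat \<Rightarrow> real) \<Rightarrow> nat \<Rightarrow> bool" where
  "recurrent_code \<nu> i \<longleftrightarrow> Suc i \<notin> range (block_start \<nu>)"

lemma strict_mono_block_start: "strict_mono (block_start \<nu>)"
  by (simp add: strict_mono_Suc_iff)

lemma recurrent_code_block:
  assumes "i < nat \<lceil>\<nu> (block_start \<nu> j)\<rceil> + 1"
  shows "recurrent_code \<nu> (i + block_start \<nu> j)"
proof -
  have "block_start \<nu> l \<noteq> Suc (i + block_start \<nu> j)" for l
  proof (cases "l \<le> j")
    case True
    then have "block_start \<nu> l \<le> block_start \<nu> j"
      using strict_mono_block_start[of \<nu>] by (simp add: strict_mono_less_eq)
    then show ?thesis by simp
  next
    case False
    then have "block_start \<nu> (Suc j) \<le> block_start \<nu> l"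
      using strict_mono_block_start[of \<nu>] by (simp add: strict_mono_less_eq del: block_start.simps)
    then show ?thesis using assms by simp
  qed
  then show ?thesis by (force simp: recurrent_code_def)
qed

lemma recurrent_code_tail_nonconstant: "(\<lambda>i. recurrent_code \<nu> (i + n)) \<noteq> (\<lambda>_. True)"
proof
  assume const: "(\<lambda>i. recurrent_code \<nu> (i + n)) = (\<lambda>_. True)"
  have "Suc n \<le> block_start \<nu> (Suc n)"
    by (rule strict_mono_imp_increasing[OF strict_mono_block_start])
  then obtain i where "block_start \<nu> (Suc n) = Suc (i + n)"
    by (metis add.commute add_Suc_right le_Suc_ex)
  then have "\<not> recurrent_code \<nu> (i + n)"
    unfolding recurrent_code_def by (metis rangeI)
  then show False using fun_cong[OF const, of i] by simp
qed

theorem theoremA: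
  fixes \<nu> :: "nat \<Rightarrow> real"
  shows "\<exists>C D. curve_germ C \<and> curve_germ D \<and>
    (\<forall>n. curve_germ (image_germ (f_map ^^ n) D) \<and>
         intersection_multiplicity C (image_germ (f_map ^^ n) D) < \<infinity>) \<and>
    infinite {n. ereal_of_enat (intersection_multiplicity C (image_germ (f_map ^^ n) D)) > ereal (\<nu> n)}"
proof (intro exI conjI allI)
  let ?s = "\<lambda>_ :: nat. True" and ?t = "recurrent_code \<nu>"
  let ?C = "graph_germ (branch ?s)" and ?D = "graph_germ (branch ?t)"
  let ?\<mu> = "\<lambda>n. subdegree (branch ?s - branch (\<lambda>i. ?t (i + n)))"
  have \<mu>: "intersection_multiplicity ?C (image_germ (f_map ^^ n) ?D) = enat (?\<mu> n)" for n
    unfolding image_germ_branch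
    using recurrent_code_tail_nonconstant[of \<nu> n] inj_branch[of ?s]
    by (intro intersection_multiplicity_graph_germs vanishing_convergent_branch) metis
  show "curve_germ ?C" "curve_germ ?D"
    by (rule curve_germ_branch)+
  show "curve_germ (image_germ (f_map ^^ n) ?D)" for n
    unfolding image_germ_branch by (rule curve_germ_branch)
  show "intersection_multiplicity ?C (image_germ (f_map ^^ n) ?D) < \<infinity>" for n
    by (simp add: \<mu>)
  have "range (block_start \<nu>) \<subseteq> {n. ereal (\<nu> n) < ereal_of_enat (enat (?\<mu> n))}"
  proof clarify
    fix j
    let ?p = "block_start \<nu> j"
    have "nat \<lceil>\<nu> ?p\<rceil> + 1 \<le> ?\<mu> ?p"
      using recurrent_code_block[of _ \<nu> j] recurrent_code_tail_nonconstant[of \<nu> ?p]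
      by (intro subdegree_branch_diff_ge) (auto simp del: One_nat_def)
    then have "\<nu> ?p < real (?\<mu> ?p)"
      by linarith
    then show "ereal (\<nu> ?p) < ereal_of_enat (enat (?\<mu> ?p))" by simp
  qed
  moreover have "infinite (range (block_start \<nu>))"
    using strict_mono_block_start by (intro range_inj_infinite strict_mono_imp_inj_on)
  ultimately show "infinite {n. ereal (\<nu> n) < ereal_of_enat (intersection_multiplicity ?C (image_germ (f_map ^^ n) ?D))}"
    unfolding \<mu> using infinite_super by blast
qed

end
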